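(* Let $L$ be a language definable in Peano arithmetic. Let $F$ be an $L$-closed family that is closed under definition by cases by open $L$-formulas and compact. Assume that $\mathbf{p}$ is a countable set of open $L(F)$-formulas in one free variable $x$. Then there is an element $\alpha\in F$ that realizes the saturation inequality for $\mathbf{p}$ in $K(F)$, i.e. $$\bigwedge_{\Phi\subseteq_f \mathbf{p}} [\![\, \exists x \bigwedge_{A\in\Phi} A(x)\,]\!]\ \le\ \bigwedge_{A\in\mathbf{p}} [\![\, A(\alpha)\,]\!]$$ in the Boolean algebra $\mathcal{B}$, where $\Phi$ runs over the finite subsets of $\mathbf{p}$.
   Context: Setting. $L$ is a countable first-order language (with equality) containing the language of Peano arithmetic, with a canonical interpretation in the standard model $\mathbf{N}$. "$L$ is definable in Peano arithmetic" means that $L$ (the set of its symbols with their arities, coded by numbers) is definable by a formula of the language of Peano arithmetic; this includes finite and recursive languages. $\mathcal{M}$ is a non-standard $\aleph_1$-saturated model of true arithmetic in the language $L$ (the $L$-theory of $\mathbf{N}$). $\Omega\in\mathcal{M}$ is an infinite set; being an element of the model, it is $\mathcal{M}$-finite. A family $F\subseteq\mathcal{M}$ is a set of functions $\alpha:\Omega\to\mathcal{M}$ that are elements of $\mathcal{M}$ (coded in $\mathcal{M}$); $F$ itself is not assumed definable in $\mathcal{M}$. Boolean algebra. $\mathcal{A}$ is the Boolean algebra of $\mathcal{M}$-definable subsets of $\Omega$. $\mathcal{I}$ is the ideal of those $U\in\mathcal{A}$ whose counting measure $|U|/|\Omega|$ (computed in $\mathcal{M}$) is infinitesimal, i.e.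 smaller than $1/k$ for every standard $k\ge 1$. $\mathcal{B}:=\mathcal{A}/\mathcal{I}$; it is known to be a complete Boolean algebra. $L$-closed. For a $k$-ary function symbol $f$ of $L$ (constants being $0$-ary) and $\alpha_1,\dots,\alpha_k\in F$, let $f(\alpha_1,\dots,\alpha_k):\Omega\to\mathcal{M}$ be $\omega\mapsto f(\alpha_1(\omega),\dots,\alpha_k(\omega))$. $F$ is $L$-closed if this function is always in $F$. The structure $K(F)$. $L(F)$ is $L$ augmented by constants for all elements of $F$. For an $L$-closed $F$, $K(F)$ is the Boolean-valued $L$-structure with universe $F$ and truth values in $\mathcal{B}$ as follows. For an atomic $L(F)$-sentence $A$, $\langle\!\langle A\rangle\!\rangle\in\mathcal{A}$ is the set of $\omega\in\Omega$ such that $A$, with each constant $\alpha\in F$ replaced by $\alpha(\omega)$, is true in $\mathcal{M}$, and $[\![A]\!]:=\langle\!\langle A\rangle\!\rangle/\mathcal{I}$. The value $[\![\cdot]\!]$ commutes with Boolean connectives, and $[\![\exists x A(x)]\!]=\bigvee_{\alpha\in F}[\![A(\alpha)]\!]$, $[\![\forall x A(x)]\!]=\bigwedge_{\alpha\in F}[\![A(\alpha)]\!]$. Open formulas are quantifier-free formulas. $F$ is closed under definitions by cases by open $L$-formulas iff whenever $\alpha,\beta\in F$ and $B(x)$ is an open $L(F)$-formula with free variable $x$, there is $\gamma\in F$ such that for all $\omega\in\Omega$: $\gamma(\omega)=\alpha(\omega)$ if $B(\alpha(\omega))$ holds (constants from $F$ in $B$ being evaluated at $\omega$), and $\gamma(\omega)=\beta(\omega)$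 otherwise. $F$ is compact iff there is an $L$-formula $H(x,y)$ (parameters from $\mathcal{M}$ allowed) such that, with $F_a:=\{b\in\mathcal{M}\mid \mathcal{M}\models H(a,b)\}$, one has $\bigcap_{k\in\mathbf{N}}F_k=F$ and $F_k\supseteq F_{k+1}$ for all $k\in\mathbf{N}$ (standard $k$). *)

theory Defs
  imports "HOL-Algebra.Lattice" "HOL-Library.Countable_Set"
begin

section \<open>First-order syntax\<close>

text \<open>
  Symbols are coded by natural numbers. A function or relation symbol is a pair of a code and an
  arity, so the same code used with two arities gives two symbols. Languages are thereby
  automatically countable. Equality belongs to the logic. The type parameter
  \<open>'c\<close> is the supply of constants that can be added to the language: the formulas of
  the language \<open>L(C)\<close> are those satisfying \<open>wf_fm L C\<close> below.
\<close>

record lang =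
  funs :: "(nat \<times> nat) set"
  rels :: "(nat \<times> nat) set"

datatype 'c tm = Var nat | Cst 'c | Fn nat "'c tm list"

datatype 'c fm =
    Top
  | Eq "'c tm" "'c tm"
  | Rel nat "'c tm list"
  | Neg "'c fm"
  | And "'c fm" "'c fm"
  | Or "'c fm" "'c fm"
  | All nat "'c fm"
  | Ex nat "'c fm"

primrec wf_tm :: "lang \<Rightarrow> 'c set \<Rightarrow> 'c tm \<Rightarrow> bool" where
  "wf_tm L C (Var x) \<longleftrightarrow> True"
| "wf_tm L C (Cst c) \<longleftrightarrow> c \<in> C"
| "wf_tm L C (Fn f ts) \<longleftrightarrow> (f, length ts) \<in> funs L \<and> list_all (wf_tm L C) ts"

primrec wf_fm :: "lang \<Rightarrow> 'c set \<Rightarrow> 'c fm \<Rightarrow> bool" where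
  "wf_fm L C Top \<longleftrightarrow> True"
| "wf_fm L C (Eq s t) \<longleftrightarrow> wf_tm L C s \<and> wf_tm L C t"
| "wf_fm L C (Rel r ts) \<longleftrightarrow> (r, length ts) \<in> rels L \<and> list_all (wf_tm L C) ts"
| "wf_fm L C (Neg A) \<longleftrightarrow> wf_fm L C A"
| "wf_fm L C (And A B) \<longleftrightarrow> wf_fm L C A \<and> wf_fm L C B"
| "wf_fm L C (Or A B) \<longleftrightarrow> wf_fm L C A \<and> wf_fm L C B"
| "wf_fm L C (All x A) \<longleftrightarrow> wf_fm L C A"
| "wf_fm L C (Ex x A) \<longleftrightarrow> wf_fm L C A"

primrec fv_tm :: "'c tm \<Rightarrow> nat set" where
  "fv_tm (Var x) = {x}"
| "fv_tm (Cst c) = {}"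
| "fv_tm (Fn f ts) = \<Union> (set (map fv_tm ts))"

primrec fv :: "'c fm \<Rightarrow> nat set" where
  "fv Top = {}"
| "fv (Eq s t) = fv_tm s \<union> fv_tm t"
| "fv (Rel r ts) = \<Union> (set (map fv_tm ts))"
| "fv (Neg A) = fv A"
| "fv (And A B) = fv A \<union> fv B"
| "fv (Or A B) = fv A \<union> fv B"
| "fv (All x A) = fv A - {x}"
| "fv (Ex x A) = fv A - {x}"

primrec open_fm :: "'c fm \<Rightarrow> bool" where
  "open_fm Top \<longleftrightarrow> True"
| "open_fm (Eq s t) \<longleftrightarrow> True"
| "open_fm (Rel r ts) \<longleftrightarrow> True"
| "open_fm (Neg A) \<longleftrightarrow> open_fm A"
| "open_fm (And A B) \<longleftrightarrow> open_fm A \<and> open_fm B"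
| "open_fm (Or A B) \<longleftrightarrow> open_fm A \<and> open_fm B"
| "open_fm (All x A) \<longleftrightarrow> False"
| "open_fm (Ex x A) \<longleftrightarrow> False"

text \<open>\<open>inst x c A\<close> is \<open>A(c)\<close>: the constant \<open>c\<close> replaces the free occurrences of \<open>x\<close>.\<close>

primrec inst_tm :: "nat \<Rightarrow> 'c \<Rightarrow> 'c tm \<Rightarrow> 'c tm" where
  "inst_tm x c (Var y) = (if y = x then Cst c else Var y)"
| "inst_tm x c (Cst d) = Cst d"
| "inst_tm x c (Fn f ts) = Fn f (map (inst_tm x c) ts)"

primrec inst :: "nat \<Rightarrow> 'c \<Rightarrow> 'c fm \<Rightarrow> 'c fm" where
  "inst x c Top = Top"
| "inst x c (Eq s t) = Eq (inst_tm x c s) (inst_tm x c t)"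
| "inst x c (Rel r ts) = Rel r (map (inst_tm x c) ts)"
| "inst x c (Neg A) = Neg (inst x c A)"
| "inst x c (And A B) = And (inst x c A) (inst x c B)"
| "inst x c (Or A B) = Or (inst x c A) (inst x c B)"
| "inst x c (All y A) = All y (if y = x then A else inst x c A)"
| "inst x c (Ex y A) = Ex y (if y = x then A else inst x c A)"

text \<open>The conjunction of a finite set of formulas, taken in some fixed order.\<close>

definition Conj :: "'c fm set \<Rightarrow> 'c fm" where
  "Conj \<Phi> = foldr And (SOME As. distinct As \<and> set As = \<Phi>) Top"


section \<open>Structures\<close>

text \<open>The universe of a structure is the whole type \<open>'m\<close>.\<close>

record 'm struc =
  fun_of :: "nat \<Rightarrow> 'm list \<Rightarrow> 'm"
  rel_of :: "nat \<Rightarrow> 'm list \<Rightarrow> bool"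

primrec eval :: "'m struc \<Rightarrow> ('c \<Rightarrow> 'm) \<Rightarrow> (nat \<Rightarrow> 'm) \<Rightarrow> 'c tm \<Rightarrow> 'm" where
  "eval M i e (Var x) = e x"
| "eval M i e (Cst c) = i c"
| "eval M i e (Fn f ts) = fun_of M f (map (eval M i e) ts)"

primrec sat :: "'m struc \<Rightarrow> ('c \<Rightarrow> 'm) \<Rightarrow> (nat \<Rightarrow> 'm) \<Rightarrow> 'c fm \<Rightarrow> bool" where
  "sat M i e Top \<longleftrightarrow> True"
| "sat M i e (Eq s t) \<longleftrightarrow> eval M i e s = eval M i e t"
| "sat M i e (Rel r ts) \<longleftrightarrow> rel_of M r (map (eval M i e) ts)"
| "sat M i e (Neg A) \<longleftrightarrow> \<not> sat M i e A"
| "sat M i e (And A B) \<longleftrightarrow> sat M i e A \<and> sat M i e B"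
| "sat M i e (Or A B) \<longleftrightarrow> sat M i e A \<or> sat M i e B"
| "sat M i e (All x A) \<longleftrightarrow> (\<forall>a. sat M i (e(x := a)) A)"
| "sat M i e (Ex x A) \<longleftrightarrow> (\<exists>a. sat M i (e(x := a)) A)"

text \<open>
  Truth of a sentence whose constants are interpreted by \<open>i\<close>. For \<open>'c = 'm\<close> and \<open>i = id\<close>
  this is truth of sentences with parameters from the structure.
\<close>

definition models :: "'m struc \<Rightarrow> ('c \<Rightarrow> 'm) \<Rightarrow> 'c fm \<Rightarrow> bool" where
  "models M i A \<longleftrightarrow> (\<forall>e. sat M i e A)"


section \<open>Arithmetic\<close>

text \<open>
  The language of Peano arithmetic is \<open>0, 1, +, \<cdot>, <\<close>; its function symbols have codes
  0 to 3 and the relation symbol has code 0.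
\<close>

definition PA_lang :: lang where
  "PA_lang = \<lparr> funs = {(0, 0), (1, 0), (2, 2), (3, 2)}, rels = {(0, 2)} \<rparr>"

definition contains_PA_lang :: "lang \<Rightarrow> bool" where
  "contains_PA_lang L \<longleftrightarrow> funs PA_lang \<subseteq> funs L \<and> rels PA_lang \<subseteq> rels L"

abbreviation zer :: "'m struc \<Rightarrow> 'm" where "zer M \<equiv> fun_of M 0 []"
abbreviation one :: "'m struc \<Rightarrow> 'm" where "one M \<equiv> fun_of M 1 []"
abbreviation add :: "'m struc \<Rightarrow> 'm \<Rightarrow> 'm \<Rightarrow> 'm" where "add M a b \<equiv> fun_of M 2 [a, b]"
abbreviation mul :: "'m struc \<Rightarrow> 'm \<Rightarrow> 'm \<Rightarrow> 'm" where "mul M a b \<equiv> fun_of M 3 [a, b]"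
abbreviation lt :: "'m struc \<Rightarrow> 'm \<Rightarrow> 'm \<Rightarrow> bool" where "lt M a b \<equiv> rel_of M 0 [a, b]"

text \<open>
  An expansion of the standard model: the symbols outside the language of Peano arithmetic have
  an arbitrary interpretation, which is the canonical one of the language under consideration.
\<close>

definition standard_model :: "nat struc \<Rightarrow> bool" where
  "standard_model N \<longleftrightarrow>
     zer N = 0 \<and> one N = 1 \<and>
     (\<forall>a b. add N a b = a + b) \<and> (\<forall>a b. mul N a b = a * b) \<and> (\<forall>a b. lt N a b \<longleftrightarrow> a < b)"

primrec numeral_of :: "'m struc \<Rightarrow> nat \<Rightarrow> 'm" where
  "numeral_of M 0 = zer M"
| "numeral_of M (Suc k) = add M (numeral_of M k) (one M)"

text \<open>A set of pairs of numbers is defined in \<open>N\<close> by a formula of the language of arithmetic.\<close>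

definition arith_definable :: "nat struc \<Rightarrow> (nat \<times> nat) set \<Rightarrow> bool" where
  "arith_definable N S \<longleftrightarrow>
     (\<exists>A x y. wf_fm PA_lang {} A \<and> x \<noteq> y \<and> fv A \<subseteq> {x, y} \<and>
        S = {(s, n). models N id (inst y n (inst x s A))})"

definition definable_lang :: "nat struc \<Rightarrow> lang \<Rightarrow> bool" where
  "definable_lang N L \<longleftrightarrow> arith_definable N (funs L) \<and> arith_definable N (rels L)"

text \<open>
  The sentences of \<open>L\<close> itself contain no added constants, so the interpretation of constants
  is irrelevant here.
\<close>

definition true_arithmetic :: "lang \<Rightarrow> nat struc \<Rightarrow> 'm struc \<Rightarrow> bool" where
  "true_arithmetic L N M \<longleftrightarrow>
     (\<forall>A :: nat fm. wf_fm L {} A \<and> fv A = {} \<and> models N id A \<longrightarrow> models M (numeral_of M) A)"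

definition nonstandard :: "'m struc \<Rightarrow> bool" where
  "nonstandard M \<longleftrightarrow> (\<exists>a. \<forall>k. a \<noteq> numeral_of M k)"

definition aleph1_saturated :: "lang \<Rightarrow> 'm struc \<Rightarrow> bool" where
  "aleph1_saturated L M \<longleftrightarrow>
     (\<forall>C x p. countable C \<and> (\<forall>A\<in>p. wf_fm L C A \<and> fv A \<subseteq> {x}) \<and>
        (\<forall>\<Phi>. finite \<Phi> \<and> \<Phi> \<subseteq> p \<longrightarrow> (\<exists>a. \<forall>A\<in>\<Phi>. models M id (inst x a A)))
        \<longrightarrow> (\<exists>a. \<forall>A\<in>p. models M id (inst x a A)))"


section \<open>Sets and functions coded in a model of arithmetic\<close>

text \<open>
  Sets are coded by Ackermann's membership: \<open>x\<close> is a member of \<open>y\<close> iff the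
  \<open>x\<close>-th binary digit of \<open>y\<close> is 1; in the standard model these are the codes of
  \<open>set_encode\<close> in \<open>HOL-Library.Nat_Bijection\<close>. The code of an \<open>M\<close>-finite set is unique,
  which identifies the set with an element of \<open>M\<close>. The graph of \<open>2\<^sup>x\<close> is expressed
  with Goedel's \<open>\<beta>\<close>-function (\<open>beta M c d i v\<close> says that \<open>v\<close> is the remainder of
  \<open>c\<close> modulo \<open>1 + (i + 1)d\<close>), so that all notions of this section are first-order
  definable in \<open>M\<close> in the language \<open>0, 1, +, \<cdot>, <\<close>.
\<close>

definition beta :: "'m struc \<Rightarrow> 'm \<Rightarrow> 'm \<Rightarrow> 'm \<Rightarrow> 'm \<Rightarrow> bool" where
  "beta M c d i v \<longleftrightarrow>
     (let m = add M (mul M (add M i (one M)) d) (one M)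
      in lt M v m \<and> (\<exists>q. c = add M (mul M q m) v))"

definition pow2 :: "'m struc \<Rightarrow> 'm \<Rightarrow> 'm \<Rightarrow> bool" where
  "pow2 M x p \<longleftrightarrow>
     (\<exists>c d. beta M c d (zer M) (one M) \<and>
        (\<forall>i v. lt M i x \<and> beta M c d i v \<longrightarrow> beta M c d (add M i (one M)) (add M v v)) \<and>
        beta M c d x p)"

definition memb :: "'m struc \<Rightarrow> 'm \<Rightarrow> 'm \<Rightarrow> bool" where
  "memb M x y \<longleftrightarrow>
     (\<exists>p q r. pow2 M x p \<and> lt M r p \<and> y = add M (mul M (add M (add M q q) (one M)) p) r)"

definition ext :: "'m struc \<Rightarrow> 'm \<Rightarrow> 'm set" where
  "ext M y = {x. memb M x y}"

text \<open>Cantor's pairing \<open>p = (x + y)(x + y + 1)/2 + x\<close>.\<close>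

definition is_pair :: "'m struc \<Rightarrow> 'm \<Rightarrow> 'm \<Rightarrow> 'm \<Rightarrow> bool" where
  "is_pair M x y p \<longleftrightarrow>
     add M p p = add M (mul M (add M x y) (add M (add M x y) (one M))) (add M x x)"

text \<open>\<open>g\<close> codes (the graph of) a function with domain \<open>U\<close>.\<close>

definition coded_fun :: "'m struc \<Rightarrow> 'm set \<Rightarrow> 'm \<Rightarrow> bool" where
  "coded_fun M U g \<longleftrightarrow>
     (\<forall>p \<in> ext M g. \<exists>u\<in>U. \<exists>v. is_pair M u v p) \<and>
     (\<forall>u\<in>U. \<exists>!v. \<exists>p \<in> ext M g. is_pair M u v p)"

definition app :: "'m struc \<Rightarrow> 'm \<Rightarrow> 'm \<Rightarrow> 'm" where
  "app M g u = (THE v. \<exists>p \<in> ext M g. is_pair M u v p)"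

text \<open>The cardinality, computed in \<open>M\<close>, of an \<open>M\<close>-finite set.\<close>

definition mcard :: "'m struc \<Rightarrow> 'm set \<Rightarrow> 'm" where
  "mcard M U = (THE n. \<exists>h. coded_fun M U h \<and> bij_betw (app M h) U {i. lt M i n})"


section \<open>The Boolean algebra\<close>

text \<open>
  In the following \<open>W\<close> is the element of \<open>M\<close> called \<open>\<Omega>\<close> in the mathematical text.
\<close>

definition def_subsets :: "lang \<Rightarrow> 'm struc \<Rightarrow> 'm \<Rightarrow> 'm set set" where
  "def_subsets L M W =
     {U. \<exists>A x. wf_fm L UNIV A \<and> fv A \<subseteq> {x} \<and> U = {w \<in> ext M W. models M id (inst x w A)}}"

text \<open>\<open>|U|/|\<Omega>| < 1/k\<close> is written as \<open>k|U| < |\<Omega>|\<close>.\<close>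

definition inf_ideal :: "lang \<Rightarrow> 'm struc \<Rightarrow> 'm \<Rightarrow> 'm set set" where
  "inf_ideal L M W =
     {U \<in> def_subsets L M W.
        \<forall>k\<ge>1. lt M (mul M (numeral_of M k) (mcard M U)) (mcard M (ext M W))}"

definition ideal_rel :: "lang \<Rightarrow> 'm struc \<Rightarrow> 'm \<Rightarrow> ('m set \<times> 'm set) set" where
  "ideal_rel L M W =
     {(U, V). U \<in> def_subsets L M W \<and> V \<in> def_subsets L M W \<and>
        (U - V) \<union> (V - U) \<in> inf_ideal L M W}"

definition quot_class :: "lang \<Rightarrow> 'm struc \<Rightarrow> 'm \<Rightarrow> 'm set \<Rightarrow> 'm set set" where
  "quot_class L M W U = ideal_rel L M W `` {U}"

definition BA :: "lang \<Rightarrow> 'm struc \<Rightarrow> 'm \<Rightarrow> 'm set set gorder" where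
  "BA L M W =
     \<lparr> carrier = def_subsets L M W // ideal_rel L M W,
       eq = (=),
       le = (\<lambda>X Y. \<exists>U\<in>X. \<exists>V\<in>Y. U - V \<in> inf_ideal L M W) \<rparr>"

text \<open>
  Complementation maps \<open>def_subsets\<close> bijectively to itself and preserves symmetric differences,
  hence the image of the class of \<open>U\<close> is the class of \<open>\<Omega> - U\<close>.
\<close>

definition BA_compl :: "'m struc \<Rightarrow> 'm \<Rightarrow> 'm set set \<Rightarrow> 'm set set" where
  "BA_compl M W X = (\<lambda>U. ext M W - U) ` X"


section \<open>Families of functions and the structure \<open>K(F)\<close>\<close>

definition family :: "'m struc \<Rightarrow> 'm \<Rightarrow> 'm set \<Rightarrow> bool" where
  "family M W F \<longleftrightarrow> (\<forall>\<alpha>\<in>F. coded_fun M (ext M W) \<alpha>)"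

definition L_closed :: "lang \<Rightarrow> 'm struc \<Rightarrow> 'm \<Rightarrow> 'm set \<Rightarrow> bool" where
  "L_closed L M W F \<longleftrightarrow>
     (\<forall>f k as. (f, k) \<in> funs L \<and> length as = k \<and> set as \<subseteq> F \<longrightarrow>
        (\<exists>\<gamma>\<in>F. \<forall>w \<in> ext M W. app M \<gamma> w = fun_of M f (map (\<lambda>\<alpha>. app M \<alpha> w) as)))"

text \<open>
  In \<open>models M (\<lambda>\<delta>. app M \<delta> w)\<close> every constant \<open>\<delta>\<close> from \<open>F\<close> is evaluated at
  \<open>w\<close>; the constant \<open>\<alpha>\<close> put for \<open>x\<close> thus contributes \<open>\<alpha>(w)\<close>.
\<close>

definition closed_def_by_cases :: "lang \<Rightarrow> 'm struc \<Rightarrow> 'm \<Rightarrow> 'm set \<Rightarrow> bool" where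
  "closed_def_by_cases L M W F \<longleftrightarrow>
     (\<forall>\<alpha>\<in>F. \<forall>\<beta>\<in>F. \<forall>B x. open_fm B \<and> wf_fm L F B \<and> fv B \<subseteq> {x} \<longrightarrow>
        (\<exists>\<gamma>\<in>F. \<forall>w \<in> ext M W.
           app M \<gamma> w = (if models M (\<lambda>\<delta>. app M \<delta> w) (inst x \<alpha> B)
                        then app M \<alpha> w else app M \<beta> w)))"

definition compact_family :: "lang \<Rightarrow> 'm struc \<Rightarrow> 'm set \<Rightarrow> bool" where
  "compact_family L M F \<longleftrightarrow>
     (\<exists>H x y. wf_fm L UNIV H \<and> x \<noteq> y \<and> fv H \<subseteq> {x, y} \<and>
        (let Fa = (\<lambda>a. {b. models M id (inst y b (inst x a H))})
         in (\<Inter>k. Fa (numeral_of M k)) = F \<and>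
            (\<forall>k. Fa (numeral_of M k) \<supseteq> Fa (numeral_of M (Suc k)))))"

definition atom_class :: "lang \<Rightarrow> 'm struc \<Rightarrow> 'm \<Rightarrow> 'm fm \<Rightarrow> 'm set set" where
  "atom_class L M W A = quot_class L M W {w \<in> ext M W. models M (\<lambda>\<delta>. app M \<delta> w) A}"

primrec rank :: "'c fm \<Rightarrow> nat" where
  "rank Top = 0"
| "rank (Eq s t) = 0"
| "rank (Rel r ts) = 0"
| "rank (Neg A) = Suc (rank A)"
| "rank (And A B) = Suc (rank A + rank B)"
| "rank (Or A B) = Suc (rank A + rank B)"
| "rank (All x A) = Suc (rank A)"
| "rank (Ex x A) = Suc (rank A)"

lemma rank_inst [simp]: "rank (inst x c A) = rank A"
  by (induction A) auto

text \<open>The truth value in \<open>K(F)\<close> of a sentence of \<open>L(F)\<close>.\<close>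

function bval :: "lang \<Rightarrow> 'm struc \<Rightarrow> 'm \<Rightarrow> 'm set \<Rightarrow> 'm fm \<Rightarrow> 'm set set" where
  "bval L M W F Top = atom_class L M W Top"
| "bval L M W F (Eq s t) = atom_class L M W (Eq s t)"
| "bval L M W F (Rel r ts) = atom_class L M W (Rel r ts)"
| "bval L M W F (Neg A) = BA_compl M W (bval L M W F A)"
| "bval L M W F (And A B) = bval L M W F A \<sqinter>\<^bsub>BA L M W\<^esub> bval L M W F B"
| "bval L M W F (Or A B) = bval L M W F A \<squnion>\<^bsub>BA L M W\<^esub> bval L M W F B"
| "bval L M W F (All x A) = \<Sqinter>\<^bsub>BA L M W\<^esub> ((\<lambda>\<alpha>. bval L M W F (inst x \<alpha> A)) ` F)"
| "bval L M W F (Ex x A) = \<Squnion>\<^bsub>BA L M W\<^esub> ((\<lambda>\<alpha>. bval L M W F (inst x \<alpha> A)) ` F)"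
  by pat_completeness auto
termination
  by (relation "measure (\<lambda>(L, M, W, F, A). rank A)") auto

end

theory Submission
  imports Defs "HOL-Number_Theory.Cong" "HOL-Library.Nat_Bijection"
begin

text \<open>
  For an open formula \<open>B(x)\<close> the sets \<open>\<langle>\<langle>B(\<alpha>)\<rangle>\<rangle>\<close> with \<open>\<alpha> \<in> F\<close> form a directed family, because \<open>F\<close> is
  closed under definition by cases. Modulo the ideal their supremum is therefore the supremum of a
  sequence, and by saturation and compactness of \<open>F\<close> some \<open>\<alpha> \<in> F\<close> contains the whole sequence in
  \<open>\<langle>\<langle>B(\<alpha>)\<rangle>\<rangle>\<close>: the value of \<open>\<exists>x B(x)\<close> is attained. Let \<open>\<alpha>\<^sub>\<Phi>\<close> attain it for the conjunction of the
  finite set \<open>\<Phi> \<subseteq> p\<close>. Again by saturation, the countable infimum on the left hand side is the class of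
  a definable set \<open>G\<close> that is contained in every \<open>\<langle>\<langle>\<And>\<Phi>(\<alpha>\<^sub>\<Phi>)\<rangle>\<rangle>\<close>. Hence the conditions
  \<open>G \<subseteq> \<langle>\<langle>A(y)\<rangle>\<rangle>\<close> for \<open>A \<in> p\<close>, together with those defining \<open>F\<close>, are finitely satisfiable by the
  \<open>\<alpha>\<^sub>\<Phi>\<close>, and an element realizing all of them is as required.

  The properties of coded sets and their cardinalities hold in the standard model, where the coding is
  the usual one, and are transferred to \<open>M\<close> as first-order sentences.
\<close>

subsection \<open>Renaming of variables and replacement of constants\<close>

primrec translate_tm :: "(nat \<Rightarrow> nat) \<Rightarrow> ('c \<Rightarrow> 'd tm) \<Rightarrow> 'c tm \<Rightarrow> 'd tm" where
  "translate_tm \<rho> \<kappa> (Var x) = Var (\<rho> x)"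
| "translate_tm \<rho> \<kappa> (Cst c) = \<kappa> c"
| "translate_tm \<rho> \<kappa> (Fn f ts) = Fn f (map (translate_tm \<rho> \<kappa>) ts)"

primrec translate :: "(nat \<Rightarrow> nat) \<Rightarrow> ('c \<Rightarrow> 'd tm) \<Rightarrow> 'c fm \<Rightarrow> 'd fm" where
  "translate \<rho> \<kappa> Top = Top"
| "translate \<rho> \<kappa> (Eq s t) = Eq (translate_tm \<rho> \<kappa> s) (translate_tm \<rho> \<kappa> t)"
| "translate \<rho> \<kappa> (Rel r ts) = Rel r (map (translate_tm \<rho> \<kappa>) ts)"
| "translate \<rho> \<kappa> (Neg A) = Neg (translate \<rho> \<kappa> A)"
| "translate \<rho> \<kappa> (And A B) = And (translate \<rho> \<kappa> A) (translate \<rho> \<kappa> B)"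
| "translate \<rho> \<kappa> (Or A B) = Or (translate \<rho> \<kappa> A) (translate \<rho> \<kappa> B)"
| "translate \<rho> \<kappa> (All x A) = All (\<rho> x) (translate \<rho> \<kappa> A)"
| "translate \<rho> \<kappa> (Ex x A) = Ex (\<rho> x) (translate \<rho> \<kappa> A)"

lemma eval_cong:
  "(\<And>n. n \<in> fv_tm t \<Longrightarrow> e n = e' n) \<Longrightarrow> (\<And>c. c \<in> set_tm t \<Longrightarrow> i c = i' c) \<Longrightarrow>
     eval M i e t = eval M i' e' t"
proof (induction t)
  case (Fn f ts)
  then have "map (eval M i e) ts = map (eval M i' e') ts" by fastforce
  then show ?case by (simp only: eval.simps)
qed auto

lemma sat_cong:
  "(\<And>n. n \<in> fv A \<Longrightarrow> e n = e' n) \<Longrightarrow> (\<And>c. c \<in> set_fm A \<Longrightarrow> i c = i' c) \<Longrightarrow>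
     sat M i e A = sat M i' e' A"
proof (induction A arbitrary: e e')
  case (Eq s t)
  then have "eval M i e s = eval M i' e' s" "eval M i e t = eval M i' e' t"
    by (auto intro!: eval_cong)
  then show ?case by simp
next
  case (Rel r ts)
  then have "map (eval M i e) ts = map (eval M i' e') ts"
    by (auto intro!: eval_cong)
  then show ?case by (simp only: sat.simps)
next
  case (Neg A)
  then have "sat M i e A = sat M i' e' A" by auto
  then show ?case by simp
next
  case (And A B)
  then have "sat M i e A = sat M i' e' A" "sat M i e B = sat M i' e' B" by auto
  then show ?case by simp
next
  case (Or A B)
  then have "sat M i e A = sat M i' e' A" "sat M i e B = sat M i' e' B" by auto
  then show ?case by simp
next
  case (All x A)
  have "sat M i (e(x := a)) A = sat M i' (e'(x := a)) A" for a
    using All.prems by (intro All.IH) auto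
  then show ?case by simp
next
  case (Ex x A)
  have "sat M i (e(x := a)) A = sat M i' (e'(x := a)) A" for a
    using Ex.prems by (intro Ex.IH) auto
  then show ?case by simp
qed auto

lemma eval_translate_tm:
  assumes "\<And>n. e' (\<rho> n) = e n"
  shows "(\<And>c. c \<in> set_tm t \<Longrightarrow> eval M j e' (\<kappa> c) = i c) \<Longrightarrow>
    eval M j e' (translate_tm \<rho> \<kappa> t) = eval M i e t"
proof (induction t)
  case (Fn f ts)
  then have "map (eval M j e') (map (translate_tm \<rho> \<kappa>) ts) = map (eval M i e) ts" by fastforce
  then show ?case by (simp only: eval.simps translate_tm.simps)
qed (simp_all add: assms)

text \<open>Injectivity of \<open>\<rho>\<close> makes an update at \<open>\<rho> x\<close> act like
  an update at \<open>x\<close>, and freshness keeps a quantifier from capturing a variable of a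
  term put for a constant.\<close>

lemma sat_translate:
  assumes inj: "inj \<rho>" and fresh: "\<And>c x. \<rho> x \<notin> fv_tm (\<kappa> c)"
  shows "(\<And>n. e' (\<rho> n) = e n) \<Longrightarrow> (\<And>c. c \<in> set_fm A \<Longrightarrow> eval M j e' (\<kappa> c) = i c) \<Longrightarrow>
    sat M j e' (translate \<rho> \<kappa> A) = sat M i e A"
proof (induction A arbitrary: e e')
  case (Eq s t)
  then show ?case using eval_translate_tm[of e' \<rho> e _ M j \<kappa> i] by auto
next
  case (Rel r ts)
  then have "map (eval M j e') (map (translate_tm \<rho> \<kappa>) ts) = map (eval M i e) ts"
    by (auto intro!: eval_translate_tm)
  then show ?case by (simp only: sat.simps translate.simps)
next
  case (Neg A)
  then have "sat M j e' (translate \<rho> \<kappa> A) = sat M i e A" by auto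
  then show ?case by simp
next
  case (And A B)
  then have "sat M j e' (translate \<rho> \<kappa> A) = sat M i e A" "sat M j e' (translate \<rho> \<kappa> B) = sat M i e B" by auto
  then show ?case by simp
next
  case (Or A B)
  then have "sat M j e' (translate \<rho> \<kappa> A) = sat M i e A" "sat M j e' (translate \<rho> \<kappa> B) = sat M i e B" by auto
  then show ?case by simp
next
  case (All x A)
  have "eval M j (e'(\<rho> x := a)) (\<kappa> c) = eval M j e' (\<kappa> c)" for a c
    using fresh by (intro eval_cong) auto
  moreover have "(e'(\<rho> x := a)) (\<rho> n) = (e(x := a)) n" for a n
    using All.prems(1) inj by (simp add: inj_eq)
  ultimately have "sat M j (e'(\<rho> x := a)) (translate \<rho> \<kappa> A) = sat M i (e(x := a)) A" for a
    using All.prems(2) by (intro All.IH) (simp_all del: fun_upd_apply)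
  then show ?case by simp
next
  case (Ex x A)
  have "eval M j (e'(\<rho> x := a)) (\<kappa> c) = eval M j e' (\<kappa> c)" for a c
    using fresh by (intro eval_cong) auto
  moreover have "(e'(\<rho> x := a)) (\<rho> n) = (e(x := a)) n" for a n
    using Ex.prems(1) inj by (simp add: inj_eq)
  ultimately have "sat M j (e'(\<rho> x := a)) (translate \<rho> \<kappa> A) = sat M i (e(x := a)) A" for a
    using Ex.prems(2) by (intro Ex.IH) (simp_all del: fun_upd_apply)
  then show ?case by simp
qed auto

lemma wf_translate_tm:
  "wf_tm L C t \<Longrightarrow> (\<And>c. c \<in> C \<Longrightarrow> wf_tm L C' (\<kappa> c)) \<Longrightarrow> wf_tm L C' (translate_tm \<rho> \<kappa> t)"
  by (induction t) (auto simp: list_all_iff)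

lemma wf_translate:
  "wf_fm L C A \<Longrightarrow> (\<And>c. c \<in> C \<Longrightarrow> wf_tm L C' (\<kappa> c)) \<Longrightarrow> wf_fm L C' (translate \<rho> \<kappa> A)"
  by (induction A) (auto simp: list_all_iff wf_translate_tm)

lemma wf_tm_iff: "wf_tm L C t \<longleftrightarrow> wf_tm L UNIV t \<and> set_tm t \<subseteq> C"
  by (induction t) (auto simp: list_all_iff)

text \<open>Formulas can thus be built over all constants first; afterwards \<open>C\<close> is cut
  down to the constants that occur, which saturation requires to be countable.\<close>

lemma wf_fm_iff: "wf_fm L C A \<longleftrightarrow> wf_fm L UNIV A \<and> set_fm A \<subseteq> C"
proof (induction A)
  case (Eq s t)
  then show ?case using wf_tm_iff[of L C] by auto
next
  case (Rel r ts)
  then show ?case using wf_tm_iff[of L C] by (auto simp: list_all_iff)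
qed auto

lemma finite_fv_tm: "finite (fv_tm t)"
  by (induction t) auto

lemma finite_fv: "finite (fv A)"
  by (induction A) (auto simp: finite_fv_tm)

lemma finite_set_tm: "finite (set_tm t)"
  by (induction t) auto

lemma finite_set_fm: "finite (set_fm A)"
  by (induction A) (auto simp: finite_set_tm)

lemma eval_inst_tm: "eval M i e (inst_tm x c t) = eval M i (e(x := i c)) t"
proof (induction t)
  case (Fn f ts)
  then have "map (eval M i e) (map (inst_tm x c) ts) = map (eval M i (e(x := i c))) ts"
    by (simp del: fun_upd_apply)
  then show ?case by (simp only: eval.simps inst_tm.simps)
qed auto

lemma sat_inst: "sat M i e (inst x c A) = sat M i (e(x := i c)) A"
proof (induction A arbitrary: e)
  case (Rel r ts)
  have "map (eval M i e) (map (inst_tm x c) ts) = map (eval M i (e(x := i c))) ts"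
    by (auto simp: eval_inst_tm)
  then show ?case by (simp only: sat.simps inst.simps)
qed (auto simp: eval_inst_tm fun_upd_twist)

lemma fv_inst_tm: "fv_tm (inst_tm x c t) = fv_tm t - {x}"
  by (induction t) auto

lemma fv_inst: "fv (inst x c A) = fv A - {x}"
  by (induction A) (auto simp: fv_inst_tm)

lemma wf_inst_tm: "wf_tm L C t \<Longrightarrow> c \<in> C \<Longrightarrow> wf_tm L C (inst_tm x c t)"
  by (induction t) (auto simp: list_all_iff)

lemma wf_inst: "wf_fm L C A \<Longrightarrow> c \<in> C \<Longrightarrow> wf_fm L C (inst x c A)"
  by (induction A) (auto simp: list_all_iff wf_inst_tm)

lemma open_inst: "open_fm (inst x c A) = open_fm A"
  by (induction A) auto

lemma models_inst:
  assumes "fv A \<subseteq> {x}"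
  shows "models M i (inst x c A) \<longleftrightarrow> sat M i (\<lambda>_. i c) A"
proof -
  have "sat M i e (inst x c A) = sat M i (\<lambda>_. i c) A" for e
    using assms by (auto simp: sat_inst intro!: sat_cong)
  then show ?thesis by (auto simp: models_def)
qed

lemma models_closed:
  assumes "fv A = {}"
  shows "models M i A \<longleftrightarrow> sat M i e A"
  using assms sat_cong[of A _ e i i M] by (auto simp: models_def)

subsection \<open>Simultaneous definability in two structures\<close>

locale structure_pair =
  fixes L :: lang and C :: "'c set"
    and M :: "'a struc" and i :: "'c \<Rightarrow> 'a"
    and N :: "'b struc" and j :: "'c \<Rightarrow> 'b"
  assumes PA: "contains_PA_lang L"
begin

text \<open>
  \<open>D P Q\<close> says that one formula defines \<open>P\<close> in \<open>M\<close> and \<open>Q\<close> in \<open>N\<close>, and \<open>T f g\<close> that one formula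
  defines the graphs of \<open>f\<close> and \<open>g\<close>. Quantifiers act on environments in de Bruijn style (variable 0
  is bound, the others are shifted), so that the closure rules below can be applied by resolution.
  With \<open>M\<close> the standard model, \<open>N\<close> a model of true arithmetic and no constants this is the relation
  needed to transfer statements; with \<open>M = N\<close>, \<open>P = Q\<close> and all constants it is definability with
  parameters.
\<close>

definition D :: "((nat \<Rightarrow> 'a) \<Rightarrow> bool) \<Rightarrow> ((nat \<Rightarrow> 'b) \<Rightarrow> bool) \<Rightarrow> bool" where
  "D P Q \<longleftrightarrow> (\<exists>A. wf_fm L C A \<and> (\<forall>e. sat M i e A = P e) \<and> (\<forall>e. sat N j e A = Q e))"

definition T :: "((nat \<Rightarrow> 'a) \<Rightarrow> 'a) \<Rightarrow> ((nat \<Rightarrow> 'b) \<Rightarrow> 'b) \<Rightarrow> bool" where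
  "T f g \<longleftrightarrow> D (\<lambda>e. e 0 = f (\<lambda>n. e (Suc n))) (\<lambda>e. e 0 = g (\<lambda>n. e (Suc n)))"

lemma D_I:
  "wf_fm L C A \<Longrightarrow> (\<And>e. sat M i e A = P e) \<Longrightarrow> (\<And>e. sat N j e A = Q e) \<Longrightarrow> D P Q"
  unfolding D_def by blast

lemma D_E:
  assumes "D P Q"
  obtains A where "wf_fm L C A" "P = (\<lambda>e. sat M i e A)" "Q = (\<lambda>e. sat N j e A)"
  using assms unfolding D_def fun_eq_iff by metis

lemma D_True: "D (\<lambda>e. True) (\<lambda>e. True)"
  by (rule D_I[of Top]) auto

lemma D_neg: "D P Q \<Longrightarrow> D (\<lambda>e. \<not> P e) (\<lambda>e. \<not> Q e)"
  by (erule D_E, rule_tac A="Neg A" in D_I) auto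

lemma D_and:
  assumes "D P Q" "D P' Q'"
  shows "D (\<lambda>e. P e \<and> P' e) (\<lambda>e. Q e \<and> Q' e)"
proof -
  obtain A where A: "wf_fm L C A" "P = (\<lambda>e. sat M i e A)" "Q = (\<lambda>e. sat N j e A)"
    using D_E[OF assms(1)] .
  obtain B where B: "wf_fm L C B" "P' = (\<lambda>e. sat M i e B)" "Q' = (\<lambda>e. sat N j e B)"
    using D_E[OF assms(2)] .
  show ?thesis unfolding A B by (rule D_I[of "And A B"]) (simp_all add: A B)
qed

lemma D_or:
  assumes "D P Q" "D P' Q'"
  shows "D (\<lambda>e. P e \<or> P' e) (\<lambda>e. Q e \<or> Q' e)"
proof -
  obtain A where A: "wf_fm L C A" "P = (\<lambda>e. sat M i e A)" "Q = (\<lambda>e. sat N j e A)"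
    using D_E[OF assms(1)] .
  obtain B where B: "wf_fm L C B" "P' = (\<lambda>e. sat M i e B)" "Q' = (\<lambda>e. sat N j e B)"
    using D_E[OF assms(2)] .
  show ?thesis unfolding A B by (rule D_I[of "Or A B"]) (simp_all add: A B)
qed

lemma D_imp: "D P Q \<Longrightarrow> D P' Q' \<Longrightarrow> D (\<lambda>e. P e \<longrightarrow> P' e) (\<lambda>e. Q e \<longrightarrow> Q' e)"
  unfolding imp_conv_disj by (intro D_or D_neg)

lemma D_iff: "D P Q \<Longrightarrow> D P' Q' \<Longrightarrow> D (\<lambda>e. P e \<longleftrightarrow> P' e) (\<lambda>e. Q e \<longleftrightarrow> Q' e)"
  unfolding iff_conv_conj_imp by (intro D_and D_imp)

lemma D_ex_upd: "D P Q \<Longrightarrow> D (\<lambda>e. \<exists>a. P (e(x := a))) (\<lambda>e. \<exists>a. Q (e(x := a)))"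
  by (erule D_E, rule_tac A="Ex x A" in D_I) auto

lemma D_rename:
  assumes "D P Q" "inj \<rho>"
  shows "D (\<lambda>e. P (\<lambda>n. e (\<rho> n))) (\<lambda>e. Q (\<lambda>n. e (\<rho> n)))"
proof -
  obtain A where A: "wf_fm L C A" "P = (\<lambda>e. sat M i e A)" "Q = (\<lambda>e. sat N j e A)"
    using D_E[OF assms(1)] .
  show ?thesis
  proof (rule D_I[of "translate \<rho> Cst A"])
    show "wf_fm L C (translate \<rho> Cst A)" using A(1) by (rule wf_translate) auto
    show "sat M i e (translate \<rho> Cst A) = P (\<lambda>n. e (\<rho> n))" for e
      unfolding A(2) using assms(2) by (intro sat_translate) auto
    show "sat N j e (translate \<rho> Cst A) = Q (\<lambda>n. e (\<rho> n))" for e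
      unfolding A(3) using assms(2) by (intro sat_translate) auto
  qed
qed

text \<open>A formula has finitely many free variables. The remaining slots are free for a
  quantifier or for intermediate values.\<close>

lemma D_finite_support:
  assumes "D P Q"
  obtains K :: nat where "\<And>e e'. (\<And>n. n < K \<Longrightarrow> e n = e' n) \<Longrightarrow> P e = P e'"
    "\<And>e e'. (\<And>n. n < K \<Longrightarrow> e n = e' n) \<Longrightarrow> Q e = Q e'"
proof -
  obtain A where A: "wf_fm L C A" "P = (\<lambda>e. sat M i e A)" "Q = (\<lambda>e. sat N j e A)"
    using D_E[OF assms(1)] .
  obtain K where K: "\<And>n. n \<in> fv A \<Longrightarrow> n < K"
    using finite_fv[of A] unfolding finite_nat_set_iff_bounded by blast
  show ?thesis
    by (rule that[of K]; unfold A(2,3); rule sat_cong) (use K in auto)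
qed

lemma D_ex:
  assumes "D (\<lambda>e. P (e 0) (\<lambda>n. e (Suc n))) (\<lambda>e. Q (e 0) (\<lambda>n. e (Suc n)))"
  shows "D (\<lambda>e. \<exists>a. P a e) (\<lambda>e. \<exists>a. Q a e)"
proof -
  obtain K where
    P: "\<And>e e'. (\<And>n. n < K \<Longrightarrow> e n = e' n) \<Longrightarrow> P (e 0) (\<lambda>n. e (Suc n)) = P (e' 0) (\<lambda>n. e' (Suc n))" and
    Q: "\<And>e e'. (\<And>n. n < K \<Longrightarrow> e n = e' n) \<Longrightarrow> Q (e 0) (\<lambda>n. e (Suc n)) = Q (e' 0) (\<lambda>n. e' (Suc n))"
    using D_finite_support[OF assms] by blast
  \<comment> \<open>The bound variable 0 moves to slot \<open>K\<close>, and the shift of the others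
    is undone below \<open>K\<close>. Later variables stay put, which keeps \<open>\<rho>\<close>
    injective.\<close>
  define \<rho> where "\<rho> n = (case n of 0 \<Rightarrow> K | Suc m \<Rightarrow> if m < K then m else n)" for n
  have "inj \<rho>" by (auto simp: inj_def \<rho>_def split: nat.splits if_splits)
  have "(\<lambda>e. \<exists>a. P ((e(K := a)) (\<rho> 0)) (\<lambda>n. (e(K := a)) (\<rho> (Suc n)))) = (\<lambda>e. \<exists>a. P a e)"
  proof (intro ext arg_cong[where f = HOL.Ex])
    fix e a
    show "P ((e(K := a)) (\<rho> 0)) (\<lambda>n. (e(K := a)) (\<rho> (Suc n))) = P a e"
      using P[of "\<lambda>n. (e(K := a)) (\<rho> n)" "case_nat a e"]
      by (auto simp: \<rho>_def split: nat.splits)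
  qed
  moreover have "(\<lambda>e. \<exists>a. Q ((e(K := a)) (\<rho> 0)) (\<lambda>n. (e(K := a)) (\<rho> (Suc n)))) = (\<lambda>e. \<exists>a. Q a e)"
  proof (intro ext arg_cong[where f = HOL.Ex])
    fix e a
    show "Q ((e(K := a)) (\<rho> 0)) (\<lambda>n. (e(K := a)) (\<rho> (Suc n))) = Q a e"
      using Q[of "\<lambda>n. (e(K := a)) (\<rho> n)" "case_nat a e"]
      by (auto simp: \<rho>_def split: nat.splits)
  qed
  ultimately show ?thesis
    using D_ex_upd[OF D_rename[OF assms \<open>inj \<rho>\<close>], of K] by simp
qed

lemma D_all:
  assumes "D (\<lambda>e. P (e 0) (\<lambda>n. e (Suc n))) (\<lambda>e. Q (e 0) (\<lambda>n. e (Suc n)))"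
  shows "D (\<lambda>e. \<forall>a. P a e) (\<lambda>e. \<forall>a. Q a e)"
  using D_neg[OF D_ex[of "\<lambda>a e. \<not> P a e" "\<lambda>a e. \<not> Q a e", OF D_neg[OF assms]]] by simp

lemma D_subst:
  assumes D: "D P Q" and T: "\<And>n. T (\<sigma> n) (\<tau> n)"
  shows "D (\<lambda>e. P (\<lambda>n. \<sigma> n e)) (\<lambda>e. Q (\<lambda>n. \<tau> n e))"
proof -
  \<comment> \<open>The odd variables hold the environment and the even ones the values of the \<open>\<sigma> n\<close>, which
    are eliminated one by one with existential quantifiers; finitely many suffice.\<close>
  define P' where "P' k E = P (\<lambda>n. if n < k then \<sigma> n (\<lambda>m. E (2*m+1)) else E (2*n))" for k :: nat and E
  define Q' where "Q' k E = Q (\<lambda>n. if n < k then \<tau> n (\<lambda>m. E (2*m+1)) else E (2*n))" for k :: nat and E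
  have step: "D (P' k) (Q' k)" for k
  proof (induction k)
    case 0
    show ?case using D_rename[OF D, of "\<lambda>n. 2*n"] by (auto simp: P'_def Q'_def inj_def)
  next
    case (Suc k)
    have odd_neq: "2*m+1 \<noteq> 2*k" for m k :: nat by presburger
    define \<rho> where "\<rho> n = (case n of 0 \<Rightarrow> 2*k | Suc m \<Rightarrow> 2*m+1)" for n :: nat
    have "inj \<rho>" by (auto simp: inj_def \<rho>_def double_not_eq_Suc_double Suc_double_not_eq_double split: nat.splits)
    from D_rename[OF T[unfolded T_def] this, of k]
    have "D (\<lambda>E. E (2*k) = \<sigma> k (\<lambda>m. E (2*m+1))) (\<lambda>E. E (2*k) = \<tau> k (\<lambda>m. E (2*m+1)))"
      by (simp add: \<rho>_def)
    from D_ex_upd[OF D_and[OF this Suc], of "2*k"]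
    have "D (\<lambda>E. \<exists>a. a = \<sigma> k (\<lambda>m. E (2*m+1)) \<and> P' k (E(2*k := a)))
            (\<lambda>E. \<exists>a. a = \<tau> k (\<lambda>m. E (2*m+1)) \<and> Q' k (E(2*k := a)))"
      by (simp only: fun_upd_other[OF odd_neq] fun_upd_same)
    moreover have "P' k (E(2*k := \<sigma> k (\<lambda>m. E (2*m+1)))) = P' (Suc k) E" for E
      unfolding P'_def by (intro arg_cong[where f = P] ext) (auto simp: less_Suc_eq odd_neq[simplified])
    moreover have "Q' k (E(2*k := \<tau> k (\<lambda>m. E (2*m+1)))) = Q' (Suc k) E" for E
      unfolding Q'_def by (intro arg_cong[where f = Q] ext) (auto simp: less_Suc_eq odd_neq[simplified])
    ultimately show ?case by (simp add: fun_eq_iff cong: conj_cong)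
  qed
  obtain K where
    P: "\<And>e e'. (\<And>n. n < K \<Longrightarrow> e n = e' n) \<Longrightarrow> P e = P e'" and
    Q: "\<And>e e'. (\<And>n. n < K \<Longrightarrow> e n = e' n) \<Longrightarrow> Q e = Q e'"
    using D_finite_support[OF D] by blast
  obtain Z where
    P': "\<And>e e'. (\<And>n. n < Z \<Longrightarrow> e n = e' n) \<Longrightarrow> P' K e = P' K e'" and
    Q': "\<And>e e'. (\<And>n. n < Z \<Longrightarrow> e n = e' n) \<Longrightarrow> Q' K e = Q' K e'"
    using D_finite_support[OF step[of K]] by blast
  \<comment> \<open>The even variables below \<open>2 * K\<close> are eliminated, and the later ones
    do not affect \<open>P\<close> and \<open>Q\<close>. So only the odd variables below
    \<open>Z\<close> matter: they return to their places in the environment, and all others go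
    beyond \<open>Z\<close>.\<close>
  define \<rho> where "\<rho> n = (if odd n \<and> n < Z then n div 2 else n + Z)" for n :: nat
  have "inj \<rho>"
  proof (rule injI)
    fix a b assume "\<rho> a = \<rho> b"
    moreover have "a = b" if "odd a" "odd b" "a div 2 = b div 2" for a b :: nat
      using that by presburger
    moreover have "a div 2 \<noteq> b + Z" if "a < Z" for a b :: nat using that by linarith
    ultimately show "a = b" unfolding \<rho>_def by (metis add_right_cancel)
  qed
  from D_rename[OF step[of K] this]
  have "D (\<lambda>e. P' K (\<lambda>n. e (\<rho> n))) (\<lambda>e. Q' K (\<lambda>n. e (\<rho> n)))" .
  moreover have "P' K (\<lambda>n. e (\<rho> n)) = P (\<lambda>n. \<sigma> n e)" for e
  proof -
    have "P' K (\<lambda>n. e (\<rho> n)) = P' K (\<lambda>n. if odd n then e (n div 2) else e (\<rho> n))"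
      by (rule P') (auto simp: \<rho>_def)
    also have "\<dots> = P (\<lambda>n. \<sigma> n e)"
      unfolding P'_def by (rule P) auto
    finally show ?thesis .
  qed
  moreover have "Q' K (\<lambda>n. e (\<rho> n)) = Q (\<lambda>n. \<tau> n e)" for e
  proof -
    have "Q' K (\<lambda>n. e (\<rho> n)) = Q' K (\<lambda>n. if odd n then e (n div 2) else e (\<rho> n))"
      by (rule Q') (auto simp: \<rho>_def)
    also have "\<dots> = Q (\<lambda>n. \<tau> n e)"
      unfolding Q'_def by (rule Q) auto
    finally show ?thesis .
  qed
  ultimately show ?thesis by simp
qed

lemma T_var: "T (\<lambda>e. e n) (\<lambda>e. e n)"
  unfolding T_def by (rule D_I[of "Eq (Var 0) (Var (Suc n))"]) auto

lemma T_cst: "c \<in> C \<Longrightarrow> T (\<lambda>e. i c) (\<lambda>e. j c)"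
  unfolding T_def by (rule D_I[of "Eq (Var 0) (Cst c)"]) auto

lemma T_shift: "T f g \<Longrightarrow> T (\<lambda>e. f (\<lambda>n. e (Suc n))) (\<lambda>e. g (\<lambda>n. e (Suc n)))"
  unfolding T_def
  by (drule D_rename[of _ _ "\<lambda>n. case n of 0 \<Rightarrow> 0 | Suc m \<Rightarrow> Suc (Suc m)"])
     (auto simp: inj_def split: nat.splits)

lemma T_subst:
  assumes f: "T f g" and \<sigma>: "\<And>n. T (\<sigma> n) (\<tau> n)"
  shows "T (\<lambda>e. f (\<lambda>n. \<sigma> n e)) (\<lambda>e. g (\<lambda>n. \<tau> n e))"
proof -
  \<comment> \<open>Variable 0 of a graph formula is the value and stays fixed; the substituted
    terms move up by one.\<close>
  define \<sigma>' where "\<sigma>' n = (case n of 0 \<Rightarrow> (\<lambda>e. e 0) | Suc m \<Rightarrow> (\<lambda>e. \<sigma> m (\<lambda>n. e (Suc n))))" for n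
  define \<tau>' where "\<tau>' n = (case n of 0 \<Rightarrow> (\<lambda>e. e 0) | Suc m \<Rightarrow> (\<lambda>e. \<tau> m (\<lambda>n. e (Suc n))))" for n
  have "T (\<sigma>' n) (\<tau>' n)" for n
    unfolding \<sigma>'_def \<tau>'_def by (cases n) (auto intro: T_var T_shift \<sigma>)
  from D_subst[OF f[unfolded T_def], of \<sigma>' \<tau>', OF this]
  show ?thesis by (simp add: T_def \<sigma>'_def \<tau>'_def)
qed

lemma D_subst3:
  assumes D: "D (\<lambda>e. R (e 0) (e 1) (e 2)) (\<lambda>e. R' (e 0) (e 1) (e 2))"
    and "T f f'" "T g g'" "T h h'"
  shows "D (\<lambda>e. R (f e) (g e) (h e)) (\<lambda>e. R' (f' e) (g' e) (h' e))"
proof -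
  define \<sigma> where "\<sigma> n = (if n = 0 then f else if n = 1 then g else h)" for n :: nat
  define \<tau> where "\<tau> n = (if n = 0 then f' else if n = 1 then g' else h')" for n :: nat
  have "T (\<sigma> n) (\<tau> n)" for n using assms by (auto simp: \<sigma>_def \<tau>_def)
  from D_subst[OF D, of \<sigma> \<tau>, OF this] show ?thesis by (simp add: \<sigma>_def \<tau>_def)
qed

lemma D_subst2:
  assumes "D (\<lambda>e. R (e 0) (e 1)) (\<lambda>e. R' (e 0) (e 1))" "T f f'" "T g g'"
  shows "D (\<lambda>e. R (f e) (g e)) (\<lambda>e. R' (f' e) (g' e))"
  using D_subst3[of "\<lambda>a b c. R a b" "\<lambda>a b c. R' a b"] assms by blast

lemma T_subst2:
  assumes T: "T (\<lambda>e. F (e 0) (e 1)) (\<lambda>e. F' (e 0) (e 1))" and "T f f'" "T g g'"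
  shows "T (\<lambda>e. F (f e) (g e)) (\<lambda>e. F' (f' e) (g' e))"
proof -
  define \<sigma> where "\<sigma> n = (if n = 0 then f else g)" for n :: nat
  define \<tau> where "\<tau> n = (if n = 0 then f' else g')" for n :: nat
  have "T (\<sigma> n) (\<tau> n)" for n using assms by (auto simp: \<sigma>_def \<tau>_def)
  from T_subst[OF T, of \<sigma> \<tau>, OF this] show ?thesis by (simp add: \<sigma>_def \<tau>_def)
qed

lemma T_subst1:
  assumes "T (\<lambda>e. F (e 0)) (\<lambda>e. F' (e 0))" "T f f'"
  shows "T (\<lambda>e. F (f e)) (\<lambda>e. F' (f' e))"
  using T_subst2[of "\<lambda>a b. F a" "\<lambda>a b. F' a"] assms by blast

lemma D_eq: "T f f' \<Longrightarrow> T g g' \<Longrightarrow> D (\<lambda>e. f e = g e) (\<lambda>e. f' e = g' e)"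
  by (rule D_subst2[of "(=)" "(=)"], rule D_I[of "Eq (Var 0) (Var 1)"]) auto

lemma D_lt: "T f f' \<Longrightarrow> T g g' \<Longrightarrow> D (\<lambda>e. lt M (f e) (g e)) (\<lambda>e. lt N (f' e) (g' e))"
  by (rule D_subst2[of "\<lambda>a b. lt M a b" "\<lambda>a b. lt N a b"], rule D_I[of "Rel 0 [Var 0, Var 1]"])
     (use PA in \<open>auto simp: contains_PA_lang_def PA_lang_def numeral_2_eq_2\<close>)

lemma T_zer: "T (\<lambda>e. zer M) (\<lambda>e. zer N)"
  unfolding T_def by (rule D_I[of "Eq (Var 0) (Fn 0 [])"])
    (use PA in \<open>auto simp: contains_PA_lang_def PA_lang_def\<close>)

lemma T_one: "T (\<lambda>e. one M) (\<lambda>e. one N)"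
  unfolding T_def by (rule D_I[of "Eq (Var 0) (Fn 1 [])"])
    (use PA in \<open>auto simp: contains_PA_lang_def PA_lang_def\<close>)

lemma T_add: "T f f' \<Longrightarrow> T g g' \<Longrightarrow> T (\<lambda>e. add M (f e) (g e)) (\<lambda>e. add N (f' e) (g' e))"
  by (rule T_subst2[of "\<lambda>a b. add M a b" "\<lambda>a b. add N a b"],
      unfold T_def, rule D_I[of "Eq (Var 0) (Fn 2 [Var 1, Var 2])"])
     (use PA in \<open>auto simp: contains_PA_lang_def PA_lang_def numeral_2_eq_2\<close>)

lemma T_mul: "T f f' \<Longrightarrow> T g g' \<Longrightarrow> T (\<lambda>e. mul M (f e) (g e)) (\<lambda>e. mul N (f' e) (g' e))"
  by (rule T_subst2[of "\<lambda>a b. mul M a b" "\<lambda>a b. mul N a b"],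
      unfold T_def, rule D_I[of "Eq (Var 0) (Fn 3 [Var 1, Var 2])"])
     (use PA in \<open>auto simp: contains_PA_lang_def PA_lang_def numeral_2_eq_2\<close>)

lemma T_numeral: "T (\<lambda>e. numeral_of M k) (\<lambda>e. numeral_of N k)"
  by (induction k) (simp_all only: numeral_of.simps T_zer T_one T_add)

lemmas D_basic = D_True D_neg D_and D_or D_imp D_iff D_ex D_all D_eq D_lt
  T_var T_zer T_one T_add T_mul T_numeral

end

subsection \<open>Coding in the standard model\<close>

definition app_rel :: "'m struc \<Rightarrow> 'm \<Rightarrow> 'm \<Rightarrow> 'm \<Rightarrow> bool" where
  "app_rel M g u v \<longleftrightarrow> (\<exists>p \<in> ext M g. is_pair M u v p)"

text \<open>
  Where the value of \<open>g\<close> at \<open>u\<close> is not unique, the description in \<open>app\<close> returns an element that need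
  not be definable; \<open>app_tot\<close> is definable everywhere.
\<close>

definition app_tot :: "'m struc \<Rightarrow> 'm \<Rightarrow> 'm \<Rightarrow> 'm" where
  "app_tot M g u = (if \<exists>!v. app_rel M g u v then app M g u else zer M)"

text \<open>Since \<open>mcard\<close> is a description, a formula is sought for its graph on
  codes.\<close>

definition card_rel :: "'m struc \<Rightarrow> 'm \<Rightarrow> 'm \<Rightarrow> bool" where
  "card_rel M u n \<longleftrightarrow> (\<exists>h. coded_fun M (ext M u) h \<and> bij_betw (app M h) (ext M u) {i. lt M i n})"

lemma mem_ext: "x \<in> ext M y \<longleftrightarrow> memb M x y"
  by (simp add: ext_def)

lemma app_eq_The: "app M g u = (THE v. app_rel M g u v)"
  by (simp add: app_def app_rel_def)

lemma app_rel_iff: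
  assumes "coded_fun M U g" "u \<in> U"
  shows "app_rel M g u v \<longleftrightarrow> v = app M g u"
proof -
  have "\<exists>!v. app_rel M g u v" using assms by (auto simp: coded_fun_def app_rel_def)
  then show ?thesis unfolding app_eq_The by (metis the_equality)
qed

lemma app_tot_eq:
  assumes "coded_fun M U g" "u \<in> U"
  shows "app_tot M g u = app M g u"
  using app_rel_iff[OF assms] by (auto simp: app_tot_def)

lemma app_tot_graph:
  "v = app_tot M g u \<longleftrightarrow>
    (\<exists>!v. app_rel M g u v) \<and> app_rel M g u v \<or> \<not> (\<exists>!v. app_rel M g u v) \<and> v = zer M"
  unfolding app_tot_def app_eq_The by (auto intro: theI2 the_equality[symmetric])

lemma bij_betw_Collect_iff:
  "bij_betw f U {i. P i} \<longleftrightarrow> (\<forall>a\<in>U. P (f a)) \<and> (\<forall>i. P i \<longrightarrow> (\<exists>!a. a \<in> U \<and> i = f a))"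
proof
  assume "bij_betw f U {i. P i}"
  then show "(\<forall>a\<in>U. P (f a)) \<and> (\<forall>i. P i \<longrightarrow> (\<exists>!a. a \<in> U \<and> i = f a))"
    unfolding bij_betw_def inj_on_def by blast
next
  assume *: "(\<forall>a\<in>U. P (f a)) \<and> (\<forall>i. P i \<longrightarrow> (\<exists>!a. a \<in> U \<and> i = f a))"
  then have "inj_on f U" unfolding inj_on_def by metis
  moreover have "f ` U = {i. P i}" using * by blast
  ultimately show "bij_betw f U {i. P i}" by (simp add: bij_betw_def)
qed

text \<open>\<open>app\<close> is a description as well. With \<open>app_rel\<close> in its place
  only quantifiers and definable relations remain, and bijectivity onto an initial segment becomes
  the existence of unique preimages.\<close>

lemma card_rel_iff:
  "card_rel M u n \<longleftrightarrow> (\<exists>h. coded_fun M (ext M u) h \<and>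
     (\<forall>a v. memb M a u \<and> app_rel M h a v \<longrightarrow> lt M v n) \<and>
     (\<forall>i. lt M i n \<longrightarrow> (\<exists>!a. memb M a u \<and> app_rel M h a i)))"
proof -
  have "bij_betw (app M h) (ext M u) {i. lt M i n} \<longleftrightarrow>
     (\<forall>a v. memb M a u \<and> app_rel M h a v \<longrightarrow> lt M v n) \<and>
     (\<forall>i. lt M i n \<longrightarrow> (\<exists>!a. memb M a u \<and> app_rel M h a i))" (is "_ \<longleftrightarrow> ?A \<and> ?B")
    if h: "coded_fun M (ext M u) h" for h
  proof -
    have r: "memb M a u \<and> app_rel M h a v \<longleftrightarrow> memb M a u \<and> v = app M h a" for a v
      using app_rel_iff[OF h] by (auto simp: mem_ext)
    show ?thesis
      unfolding r using bij_betw_Collect_iff[of "app M h" "ext M u"] by (auto simp: mem_ext)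
  qed
  then show ?thesis unfolding card_rel_def by (intro ex_cong1 conj_cong refl)
qed

lemma mcard_ext: "mcard M (ext M u) = (THE n. card_rel M u n)"
  by (simp add: mcard_def card_rel_def)

context structure_pair
begin

text \<open>Substitution reduces the claim to variables. Unfolding then exposes a first-order
  condition, which the closure rules assemble by resolution. The next lemmas proceed alike.\<close>

lemma D_pow2: "T f f' \<Longrightarrow> T g g' \<Longrightarrow> D (\<lambda>e. pow2 M (f e) (g e)) (\<lambda>e. pow2 N (f' e) (g' e))"
  by (rule D_subst2[of "pow2 M" "pow2 N"], unfold pow2_def beta_def Let_def, intro D_basic)

lemma D_memb: "T f f' \<Longrightarrow> T g g' \<Longrightarrow> D (\<lambda>e. memb M (f e) (g e)) (\<lambda>e. memb N (f' e) (g' e))"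
  by (rule D_subst2[of "memb M" "memb N"], unfold memb_def, intro D_basic D_pow2)

lemma D_app_rel: "T f f' \<Longrightarrow> T g g' \<Longrightarrow> T h h' \<Longrightarrow>
    D (\<lambda>e. app_rel M (f e) (g e) (h e)) (\<lambda>e. app_rel N (f' e) (g' e) (h' e))"
  by (rule D_subst3[of "app_rel M" "app_rel N"],
      unfold app_rel_def Bex_def mem_ext is_pair_def, intro D_basic D_memb)

lemma D_coded_fun: "T f f' \<Longrightarrow> T g g' \<Longrightarrow>
    D (\<lambda>e. coded_fun M (ext M (f e)) (g e)) (\<lambda>e. coded_fun N (ext N (f' e)) (g' e))"
  by (rule D_subst2[of "\<lambda>a. coded_fun M (ext M a)" "\<lambda>a. coded_fun N (ext N a)"],
      unfold coded_fun_def Bex_def Ball_def Ex1_def mem_ext is_pair_def, intro D_basic D_memb)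

lemma D_card_rel: "T f f' \<Longrightarrow> T g g' \<Longrightarrow>
    D (\<lambda>e. card_rel M (f e) (g e)) (\<lambda>e. card_rel N (f' e) (g' e))"
  by (rule D_subst2[of "card_rel M" "card_rel N"],
      unfold card_rel_iff Ex1_def, intro D_basic D_memb D_coded_fun D_app_rel)

lemma T_app_tot: "T f f' \<Longrightarrow> T g g' \<Longrightarrow>
    T (\<lambda>e. app_tot M (f e) (g e)) (\<lambda>e. app_tot N (f' e) (g' e))"
  by (rule T_subst2[of "app_tot M" "app_tot N"],
      unfold T_def app_tot_graph Ex1_def, intro D_basic D_memb D_app_rel)

text \<open>Where \<open>card_rel\<close> has exactly one solution, the description returns it and
  so has \<open>card_rel\<close> as its graph. For \<open>M\<close> this uniqueness is itself
  obtained by transfer.\<close>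

lemma T_mcard:
  assumes "\<And>u. \<exists>!n. card_rel M u n" "\<And>u. \<exists>!n. card_rel N u n"
  shows "T f f' \<Longrightarrow> T (\<lambda>e. mcard M (ext M (f e))) (\<lambda>e. mcard N (ext N (f' e)))"
proof (rule T_subst1[of "\<lambda>u. mcard M (ext M u)" "\<lambda>u. mcard N (ext N u)"])
  have "n = mcard M (ext M u) \<longleftrightarrow> card_rel M u n" for n u
    unfolding mcard_ext using assms(1)[of u] by (metis the_equality)
  moreover have "n = mcard N (ext N u) \<longleftrightarrow> card_rel N u n" for n u
    unfolding mcard_ext using assms(2)[of u] by (metis the_equality)
  ultimately show "T (\<lambda>e. mcard M (ext M (e 0))) (\<lambda>e. mcard N (ext N (e 0)))"
    unfolding T_def by (simp only:) (intro D_basic D_card_rel)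
qed

lemmas D_intros = D_basic D_memb D_coded_fun D_app_rel D_card_rel T_app_tot

end

lemma fv_foldr_All: "fv (foldr All xs A) = fv A - set xs"
  by (induction xs) auto

lemma wf_foldr_All: "wf_fm L C (foldr All xs A) = wf_fm L C A"
  by (induction xs) auto

lemma sat_foldr_All: "sat M i e (foldr All xs A) \<Longrightarrow> sat M i e A"
proof (induction xs arbitrary: e)
  case (Cons x xs)
  then have "sat M i (e(x := e x)) (foldr All xs A)" by (simp del: fun_upd_triv)
  then show ?case using Cons.IH by simp
qed simp

lemma sat_foldr_AllI: "(\<And>e. sat M i e A) \<Longrightarrow> sat M i e (foldr All xs A)"
  by (induction xs arbitrary: e) auto

subsection \<open>Transfer to models of true arithmetic\<close>

locale true_arith =
  fixes L :: lang and N :: "nat struc" and M :: "'m struc"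
  assumes PA: "contains_PA_lang L" and std: "standard_model N"
    and tru: "true_arithmetic L N M"
begin

sublocale tr: structure_pair L "{} :: nat set" N id M "numeral_of M"
  by unfold_locales (rule PA)

sublocale df: structure_pair L "UNIV :: 'm set" M id M id
  by unfold_locales (rule PA)

text \<open>True arithmetic speaks of sentences, so the formula is first closed by universal
  quantifiers, and the result is instantiated with the environment.\<close>

lemma transfer:
  assumes "tr.D P Q" "\<And>e. P e"
  shows "Q e"
proof -
  obtain A where A: "wf_fm L {} A" "P = (\<lambda>e. sat N id e A)" "Q = (\<lambda>e. sat M (numeral_of M) e A)"
    using tr.D_E[OF assms(1)] .
  obtain xs where xs: "set xs = fv A" using finite_list[OF finite_fv] by blast
  have "wf_fm L {} (foldr All xs A) \<and> fv (foldr All xs A) = {} \<and> models N id (foldr All xs A)"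
    using A assms(2) xs by (auto simp: fv_foldr_All wf_foldr_All models_def sat_foldr_AllI)
  then have "models M (numeral_of M) (foldr All xs A)"
    using tru by (auto simp: true_arithmetic_def)
  then show ?thesis unfolding A(3) models_def by (blast intro: sat_foldr_All)
qed

lemma transfer_sentence: "tr.D (\<lambda>_. P) (\<lambda>_. Q) \<Longrightarrow> P \<Longrightarrow> Q"
  by (rule transfer)

section \<open>The coding computed in the standard model\<close>

lemma std_simps [simp]:
  "zer N = 0" "one N = 1" "fun_of N 1 [] = 1" "fun_of N (Suc 0) [] = 1"
  "add N a b = a + b" "mul N a b = a * b" "lt N a b \<longleftrightarrow> a < b"
  using std by (auto simp: standard_model_def)

lemma numeral_N [simp]: "numeral_of N k = k"
  by (induction k) auto

lemma beta_N: "beta N c d i v \<longleftrightarrow> v = c mod ((i + 1) * d + 1)"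
proof -
  have "v < m \<and> (\<exists>q. c = q * m + v) \<longleftrightarrow> v = c mod m" if "m > 0" for m :: nat
    using that by (metis div_mult_mod_eq mod_less mod_less_divisor mod_mult_self3)
  from this[of "(i + 1) * d + 1"] show ?thesis
    by (simp only: beta_def Let_def std_simps)
qed

lemma beta_coding:
  fixes f :: "nat \<Rightarrow> nat"
  shows "\<exists>c d. \<forall>i\<le>n. f i = c mod ((i + 1) * d + 1)"
proof -
  \<comment> \<open>Goedel's moduli: for \<open>d = b!\<close> they are pairwise coprime, and larger than the values of \<open>f\<close>.\<close>
  define b where "b = Suc (n + (\<Sum>i\<le>n. f i))"
  define d where "d = (fact b :: nat)"
  define m where "m i = (i + 1) * d + 1" for i
  have lt_m: "f i < m i" if "i \<le> n" for i
  proof -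
    have "f i \<le> (\<Sum>i\<le>n. f i)" using that by (intro member_le_sum) auto
    also have "\<dots> < b" by (simp add: b_def)
    also have "b \<le> d" unfolding d_def by (rule fact_ge_self)
    also have "d < m i" by (simp add: m_def)
    finally show ?thesis .
  qed
  have cop: "coprime (m i) (m j)" if "i < j" "j \<le> n" for i j
  proof (rule ccontr)
    assume "\<not> coprime (m i) (m j)"
    then obtain q where q: "prime q" "q dvd m i" "q dvd m j"
      by (metis coprime_iff_gcd_eq_1 gcd_nat.bounded_iff prime_factor_nat)
    \<comment> \<open>This combination cancels \<open>d\<close>. A common prime \<open>q\<close> is
      therefore at most \<open>j - i\<close>, so it divides the factorial \<open>d\<close>, and
      hence 1.\<close>
    have "q dvd (j + 1) * m i - (i + 1) * m j" using q by (intro dvd_diff_nat) auto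
    also have "(j + 1) * m i - (i + 1) * m j = j - i" by (simp add: m_def algebra_simps)
    finally have "q \<le> j - i" using that by (auto dest: dvd_imp_le)
    then have "q \<le> b" using that by (simp add: b_def)
    then have "q dvd d" unfolding d_def using q(1) prime_dvd_fact_iff by blast
    then have "q dvd 1" using q(2) unfolding m_def by (meson dvd_add_right_iff dvd_mult)
    then show False using q(1) by simp
  qed
  have "\<exists>c. \<forall>i\<in>{..n}. [c = f i] (mod (m i))"
  proof (rule chinese_remainder_nat)
    show "\<forall>i\<in>{..n}. \<forall>j\<in>{..n}. i \<noteq> j \<longrightarrow> coprime (m i) (m j)"
      using cop by (metis atMost_iff coprime_commute nat_neq_iff)
  qed simp
  then obtain c where "\<forall>i\<le>n. [c = f i] (mod (m i))" by auto
  then have "\<forall>i\<le>n. f i = c mod m i" using lt_m by (auto simp: cong_def)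
  then show ?thesis unfolding m_def by blast
qed

text \<open>A sequence that starts with 1 and doubles up to index \<open>x\<close> consists of the
  powers of 2; conversely, \<open>beta_coding\<close> provides a code of this sequence.\<close>

lemma pow2_N: "pow2 N x p \<longleftrightarrow> p = 2 ^ x"
proof
  assume "pow2 N x p"
  then obtain c d where c: "beta N c d 0 1" "\<And>i v. i < x \<Longrightarrow> beta N c d i v \<Longrightarrow> beta N c d (i + 1) (v + v)"
    "beta N c d x p"
    by (auto simp: pow2_def)
  have "i \<le> x \<Longrightarrow> beta N c d i (2 ^ i)" for i
  proof (induction i)
    case (Suc i)
    then show ?case using c(2)[of i "2 ^ i"] by (simp add: mult_2)
  qed (use c(1) in simp)
  then show "p = 2 ^ x" using c(3) by (simp add: beta_N)
next
  assume p: "p = 2 ^ x"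
  obtain c d where "\<forall>i\<le>x. 2 ^ i = c mod ((i + 1) * d + 1)" using beta_coding by blast
  then have b: "beta N c d i v \<longleftrightarrow> v = 2 ^ i" if "i \<le> x" for i v
    using that by (metis beta_N)
  show "pow2 N x p" unfolding pow2_def
    by (rule exI[of _ c], rule exI[of _ d]) (auto simp: b p mult_2)
qed

text \<open>Splitting off the remainder \<open>r\<close> leaves the quotient
  \<open>q + q + 1\<close>, so membership is oddness of \<open>y div 2 ^ x\<close>, as in
  \<open>set_decode\<close>.\<close>

lemma memb_N [simp]: "memb N x y \<longleftrightarrow> x \<in> set_decode y"
proof -
  have "(\<exists>q r. r < 2 ^ x \<and> y = (q + q + 1) * 2 ^ x + r) \<longleftrightarrow> odd (y div 2 ^ x)"
  proof
    assume "\<exists>q r. r < 2 ^ x \<and> y = (q + q + 1) * 2 ^ x + r"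
    then obtain q r where "r < 2 ^ x" "y = (q + q + 1) * 2 ^ x + r" by blast
    then have "y div 2 ^ x = q + q + 1" by (metis add.right_neutral div_less div_mult_self3 less_nat_zero_code power_eq_0_iff add.commute)
    then show "odd (y div 2 ^ x)" by simp
  next
    assume "odd (y div 2 ^ x)"
    then obtain q where "y div 2 ^ x = 2 * q + 1" by (rule oddE)
    then have "y = (q + q + 1) * 2 ^ x + y mod 2 ^ x" by (metis div_mult_mod_eq mult_2)
    then show "\<exists>q r. r < 2 ^ x \<and> y = (q + q + 1) * 2 ^ x + r"
      by (metis mod_less_divisor zero_less_numeral zero_less_power)
  qed
  then show ?thesis by (auto simp: memb_def pow2_N set_decode_def)
qed

lemma ext_N [simp]: "ext N y = set_decode y"
  by (auto simp: mem_ext)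

lemma is_pair_N [simp]: "is_pair N x y p \<longleftrightarrow> p = prod_encode (x, y)"
proof -
  have "2 * triangle n = n * (n + 1)" for n
    by (simp add: triangle_def)
  from this[of "x + y"] show ?thesis
    by (auto simp: is_pair_def prod_encode_def)
qed

lemma card_rel_N: "card_rel N u n \<longleftrightarrow> n = card (set_decode u)"
proof
  assume "card_rel N u n"
  then obtain h where "bij_betw (app N h) (set_decode u) {i. i < n}" by (auto simp: card_rel_def)
  then show "n = card (set_decode u)" by (metis bij_betw_same_card card_Collect_less_nat)
next
  assume n: "n = card (set_decode u)"
  then obtain f where f: "bij_betw f (set_decode u) {..<n}"
    using ex_bij_betw_finite_nat[of "set_decode u"] by (auto simp: lessThan_atLeast0)
  \<comment> \<open>The code of the graph of \<open>f\<close>, which is a finite set.\<close>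
  define h where "h = set_encode ((\<lambda>a. prod_encode (a, f a)) ` set_decode u)"
  have h: "set_decode h = (\<lambda>a. prod_encode (a, f a)) ` set_decode u"
    by (simp add: h_def)
  have c: "coded_fun N (ext N u) h"
    by (auto simp: coded_fun_def h)
  have "app N h a = f a" if "a \<in> set_decode u" for a
    using app_rel_iff[OF c, of a "f a"] that by (auto simp: app_rel_def h)
  then have "bij_betw (app N h) (set_decode u) {..<n}"
    using bij_betw_cong[of "set_decode u" "app N h" f] f by blast
  then have "bij_betw (app N h) (ext N u) {i. lt N i n}"
    by (simp add: lessThan_def)
  then show "card_rel N u n" using c unfolding card_rel_def by blast
qed

lemma card_rel_ex1: "\<exists>!n. card_rel M u n"
proof -
  have "\<forall>u. \<exists>!n. card_rel M u n"
  proof (rule transfer)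
    show "tr.D (\<lambda>e. \<forall>u. \<exists>!n. card_rel N u n) (\<lambda>e. \<forall>u. \<exists>!n. card_rel M u n)"
      unfolding Ex1_def by (intro tr.D_intros)
  qed (simp add: card_rel_N)
  then show ?thesis by blast
qed

lemma mcard_N [simp]: "mcard N (set_decode u) = card (set_decode u)"
  using mcard_ext[of N u] by (simp add: card_rel_N)

lemmas T_mcard = tr.T_mcard[OF _ card_rel_ex1, unfolded card_rel_N, simplified]
lemmas DefT_mcard = df.T_mcard[OF card_rel_ex1 card_rel_ex1]

end

subsection \<open>Comprehension and saturation for definable predicates\<close>

text \<open>Even variables of \<open>B\<close> carry the environment and odd ones the values of the
  constants. Parameters thereby become variables, over which a transferred statement can
  quantify.\<close>

lemma constant_elimination:
  fixes A :: "'c fm"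
  assumes "wf_fm L C A"
  obtains B :: "'d fm" and c :: "nat \<Rightarrow> 'c" where "wf_fm L {} B"
    "\<And>(M :: 'm struc) i j e. sat M j (\<lambda>n. if even n then e (n div 2) else i (c (n div 2))) B = sat M i e A"
proof
  let ?\<kappa> = "\<lambda>c. Var (2 * to_nat_on (set_fm A) c + 1) :: 'd tm"
  let ?B = "translate (\<lambda>n. 2 * n) ?\<kappa> A"
  let ?c = "from_nat_into (set_fm A)"
  show "wf_fm L {} ?B" using assms by (rule wf_translate) simp
  fix M :: "'m struc" and i j e
  show "sat M j (\<lambda>n. if even n then e (n div 2) else i (?c (n div 2))) ?B = sat M i e A"
  proof (rule sat_translate)
    show "inj (\<lambda>n::nat. 2 * n)" by (simp add: inj_def)
    show "2 * x \<notin> fv_tm (?\<kappa> c)" for x c by (simp add: double_not_eq_Suc_double)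
    show "(if even (2 * n) then e (2 * n div 2) else i (?c (2 * n div 2))) = e n" for n :: nat
      by simp
    show "eval M j (\<lambda>n. if even n then e (n div 2) else i (?c (n div 2))) (?\<kappa> c) = i c"
      if "c \<in> set_fm A" for c
      using that finite_set_fm[of A] by (simp add: countable_finite)
  qed
qed

text \<open>Vacuous quantifiers remove variables that occur syntactically but do not influence the
  truth value. Saturation and \<open>def_subsets\<close> demand formulas with one free variable in
  the syntactic sense.\<close>

lemma sat_foldr_Ex:
  assumes "\<And>e e'. e 0 = e' 0 \<Longrightarrow> sat M i e A = sat M i e' A" "0 \<notin> set xs"
  shows "sat M i e (foldr Ex xs A) = sat M i e A"
  using assms(2)
proof (induction xs arbitrary: e)
  case (Cons x xs)
  then have "sat M i (e(x := a)) (foldr Ex xs A) = sat M i e A" for a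
    using assms(1)[of "e(x := a)" e] by simp
  then show ?case by simp
qed simp

lemma fv_foldr_Ex: "fv (foldr Ex xs A) = fv A - set xs"
  by (induction xs) auto

lemma wf_foldr_Ex: "wf_fm L C (foldr Ex xs A) = wf_fm L C A"
  by (induction xs) auto

context true_arith
begin

abbreviation mc :: "'m \<Rightarrow> 'm" where "mc u \<equiv> mcard M (ext M u)"

abbreviation Def :: "((nat \<Rightarrow> 'm) \<Rightarrow> bool) \<Rightarrow> bool" where "Def P \<equiv> df.D P P"

abbreviation DefT :: "((nat \<Rightarrow> 'm) \<Rightarrow> 'm) \<Rightarrow> bool" where "DefT f \<equiv> df.T f f"

lemma DefT_const: "DefT (\<lambda>e. a)"
  using df.T_cst[of a] by simp

lemmas Def_intros = df.D_intros DefT_const DefT_mcard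

lemma sat_D: "wf_fm L {} A \<Longrightarrow> tr.D (\<lambda>e. sat N id e A) (\<lambda>e. sat M (numeral_of M) e A)"
  by (rule tr.D_I) auto

lemma sat_Def: "wf_fm L UNIV A \<Longrightarrow> Def (\<lambda>e. sat M id e A)"
  by (rule df.D_I) auto

text \<open>In the standard model the required set is a subset of a finite set, so
  \<open>set_encode\<close> gives its code. The environment is arbitrary and supplies the
  parameters.\<close>

lemma comprehension_constant_free:
  assumes "wf_fm L {} B"
  shows "\<exists>u. \<forall>a. memb M a u \<longleftrightarrow> memb M a (e 0) \<and> sat M (numeral_of M) (\<lambda>n. if n = y then a else e (Suc n)) B"
proof (rule transfer)
  \<comment> \<open>Under both quantifiers 0 is \<open>a\<close>, 1 is \<open>u\<close> and the old
    environment begins at 2 with the bounding set. The parameters therefore begin at 3.\<close>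
  have "inj (\<lambda>n. if n = y then 0 else Suc (Suc (Suc n)))"
    by (auto simp: inj_def)
  from tr.D_rename[OF sat_D[OF assms] this]
  have "tr.D (\<lambda>e. sat N id (\<lambda>n. if n = y then e 0 else e (Suc (Suc (Suc n)))) B)
             (\<lambda>e. sat M (numeral_of M) (\<lambda>n. if n = y then e 0 else e (Suc (Suc (Suc n)))) B)"
    by (simp add: if_distrib cong: if_cong)
  then show "tr.D (\<lambda>e. \<exists>u. \<forall>a. memb N a u \<longleftrightarrow> memb N a (e 0) \<and> sat N id (\<lambda>n. if n = y then a else e (Suc n)) B)
    (\<lambda>e. \<exists>u. \<forall>a. memb M a u \<longleftrightarrow> memb M a (e 0) \<and> sat M (numeral_of M) (\<lambda>n. if n = y then a else e (Suc n)) B)"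
    by (intro tr.D_intros)
next
  fix e
  have "set_decode (set_encode {a \<in> set_decode (e 0). sat N id (\<lambda>n. if n = y then a else e (Suc n)) B})
      = {a \<in> set_decode (e 0). sat N id (\<lambda>n. if n = y then a else e (Suc n)) B}"
    by simp
  then show "\<exists>u. \<forall>a. memb N a u \<longleftrightarrow> memb N a (e 0) \<and> sat N id (\<lambda>n. if n = y then a else e (Suc n)) B"
    unfolding memb_N by blast
qed

lemma comprehension:
  assumes "Def (\<lambda>e. Q (e 0))"
  obtains u where "ext M u = {a \<in> ext M w. Q a}"
proof -
  obtain A where A: "wf_fm L UNIV A" and Q: "\<And>e. sat M id e A = Q (e 0)"
    using df.D_E[OF assms] by metis
  obtain B :: "nat fm" and c where B: "wf_fm L {} B"
    and sat_B: "\<And>(M :: 'm struc) i j e. sat M j (\<lambda>n. if even n then e (n div 2) else i (c (n div 2))) B = sat M i e A"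
    using constant_elimination[OF A, where 'd = nat and 'm = 'm] by blast
  \<comment> \<open>Position 0 holds the bounding set, and the later ones make variable
    \<open>2 * k + 1\<close> of \<open>B\<close> equal to the constant \<open>c k\<close>. Even
    variables other than 0 may take any value, since \<open>Q\<close> looks at variable 0
    only.\<close>
  define e where "e n = (case n of 0 \<Rightarrow> w | Suc m \<Rightarrow> id (c (m div 2)))" for n
  obtain u where u: "\<forall>a. memb M a u \<longleftrightarrow> memb M a w \<and>
      sat M (numeral_of M) (\<lambda>n. if n = 0 then a else e (Suc n)) B"
    using comprehension_constant_free[OF B, of e 0] by (auto simp: e_def)
  have "sat M (numeral_of M) (\<lambda>n. if n = 0 then a else e (Suc n)) B = Q a" for a
  proof -
    have "(\<lambda>n. if n = 0 then a else e (Suc n)) =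
       (\<lambda>n. if even n then (\<lambda>m. if m = 0 then a else id (c m)) (n div 2) else id (c (n div 2)))"
      by (auto simp: e_def fun_eq_iff)
    then show ?thesis using sat_B[where j = "numeral_of M" and e = "\<lambda>m. if m = 0 then a else id (c m)" and i = id] Q
      by simp
  qed
  then show ?thesis using u that[of u] by (simp add: set_eq_iff mem_ext)
qed

lemma Def_closed_formula:
  assumes "Def (\<lambda>e. Q (e 0))"
  shows "\<exists>A. wf_fm L UNIV A \<and> fv A \<subseteq> {0} \<and> (\<forall>a. models M id (inst 0 a A) = Q a)"
proof -
  obtain A where A: "wf_fm L UNIV A" and Q: "\<And>e. sat M id e A = Q (e 0)"
    using df.D_E[OF assms] by metis
  obtain xs where xs: "set xs = fv A - {0}" using finite_list[of "fv A - {0}"] finite_fv by blast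
  have fv: "fv (foldr Ex xs A) \<subseteq> {0}" using xs by (auto simp: fv_foldr_Ex)
  have "models M id (inst 0 a (foldr Ex xs A)) = Q a" for a
    unfolding models_inst[OF fv] using xs by (subst sat_foldr_Ex) (auto simp: Q)
  then show ?thesis using A fv by (metis wf_foldr_Ex)
qed

text \<open>Definable predicates take the place of formulas. Each chosen formula has finitely many
  constants, so countably many predicates stay within a countable set of them.\<close>

lemma saturation:
  assumes sat: "aleph1_saturated L M" and "countable \<Q>"
    and Def: "\<And>Q. Q \<in> \<Q> \<Longrightarrow> Def (\<lambda>e. Q (e 0))"
    and fin: "\<And>\<F>. finite \<F> \<Longrightarrow> \<F> \<subseteq> \<Q> \<Longrightarrow> \<exists>a. \<forall>Q\<in>\<F>. Q a"
  shows "\<exists>a. \<forall>Q\<in>\<Q>. Q a"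
proof -
  have "\<forall>Q\<in>\<Q>. \<exists>A. wf_fm L UNIV A \<and> fv A \<subseteq> {0} \<and> (\<forall>a. models M id (inst 0 a A) = Q a)"
    by (intro ballI Def_closed_formula) (rule Def)
  then obtain A where A: "\<And>Q. Q \<in> \<Q> \<Longrightarrow> wf_fm L UNIV (A Q) \<and> fv (A Q) \<subseteq> {0}"
    and Q: "\<And>Q a. Q \<in> \<Q> \<Longrightarrow> models M id (inst 0 a (A Q)) = Q a"
    by metis
  define C where "C = (\<Union>Q\<in>\<Q>. set_fm (A Q))"
  have "countable C" unfolding C_def
    using \<open>countable \<Q>\<close> by (auto intro: countable_finite finite_set_fm)
  moreover have "\<forall>B\<in>A ` \<Q>. wf_fm L C B \<and> fv B \<subseteq> {0}"
    using A wf_fm_iff[of L C] by (fastforce simp: C_def)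
  moreover have "\<exists>a. \<forall>B\<in>\<Phi>. models M id (inst 0 a B)" if \<Phi>: "finite \<Phi>" "\<Phi> \<subseteq> A ` \<Q>" for \<Phi>
  proof -
    obtain \<F> where \<F>: "\<F> \<subseteq> \<Q>" "finite \<F>" "\<Phi> = A ` \<F>"
      using finite_subset_image[OF \<Phi>] by blast
    then obtain a where "\<forall>Q\<in>\<F>. Q a" using fin by blast
    then show ?thesis using \<F> Q by blast
  qed
  ultimately have "\<exists>a. \<forall>B\<in>A ` \<Q>. models M id (inst 0 a B)"
    using sat[unfolded aleph1_saturated_def, rule_format, of C "A ` \<Q>" 0] by blast
  then show ?thesis using Q by blast
qed

section \<open>The algebra of definable subsets of \<Omega>\<close>

text \<open>Comprehension codes every definable subset of the \<open>M\<close>-finite \<Omega>, and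
  a coded set is definable with its code as a parameter. Statements about all definable subsets thus
  become statements about elements of \<open>M\<close>.\<close>

lemma def_subsets_iff: "U \<in> def_subsets L M W \<longleftrightarrow> U \<subseteq> ext M W \<and> (\<exists>u. ext M u = U)"
proof
  assume "U \<in> def_subsets L M W"
  then obtain A x where A: "wf_fm L UNIV A" "fv A \<subseteq> {x}"
    and U: "U = {w \<in> ext M W. models M id (inst x w A)}"
    by (auto simp: def_subsets_def)
  \<comment> \<open>Giving all variables the same value is harmless, since at most \<open>x\<close>
    is free.\<close>
  have "Def (\<lambda>e. sat M id (\<lambda>_. e 0) A)"
    using df.D_subst[OF sat_Def[OF A(1)], of "\<lambda>n e. e 0" "\<lambda>n e. e 0"] df.T_var by simp
  then have "Def (\<lambda>e. models M id (inst x (e 0) A))"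
    by (simp add: models_inst[OF A(2)])
  from comprehension[OF this, of W] show "U \<subseteq> ext M W \<and> (\<exists>u. ext M u = U)"
    using U by blast
next
  assume "U \<subseteq> ext M W \<and> (\<exists>u. ext M u = U)"
  then obtain u where u: "ext M u \<subseteq> ext M W" "U = ext M u" by blast
  have "Def (\<lambda>e. memb M (e 0) u)" by (intro Def_intros)
  from Def_closed_formula[OF this] obtain A where
    "wf_fm L UNIV A" "fv A \<subseteq> {0}" "\<And>a. models M id (inst 0 a A) = memb M a u"
    by blast
  then show "U \<in> def_subsets L M W"
    unfolding def_subsets_def using u by (intro CollectI exI[of _ A] exI[of _ 0]) (auto simp: mem_ext)
qed

lemma def_subsetsE:
  assumes "U \<in> def_subsets L M W"
  obtains u where "ext M u = U" "ext M u \<subseteq> ext M W"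
  using assms unfolding def_subsets_iff by blast

lemma Def_def_subsets:
  assumes "Def (\<lambda>e. Q (e 0))"
  shows "{w \<in> ext M W. Q w} \<in> def_subsets L M W"
proof -
  obtain u where "ext M u = {w \<in> ext M W. Q w}" by (rule comprehension[OF assms])
  then show ?thesis unfolding def_subsets_iff by (intro conjI exI[of _ u]) simp_all
qed

lemma def_subsets_subset: "U \<in> def_subsets L M W \<Longrightarrow> U \<subseteq> ext M W"
  by (simp add: def_subsets_iff)

lemma def_subsets_Diff:
  assumes "U \<in> def_subsets L M W" "V \<in> def_subsets L M W"
  shows "U - V \<in> def_subsets L M W"
proof -
  obtain u v where uv: "ext M u = U" "ext M v = V" using assms by (metis def_subsetsE)
  have "Def (\<lambda>e. memb M (e 0) u \<and> \<not> memb M (e 0) v)" by (intro Def_intros)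
  from Def_def_subsets[OF this, of W] have "{w \<in> ext M W. w \<in> U \<and> w \<notin> V} \<in> def_subsets L M W"
    by (simp add: mem_ext flip: uv)
  moreover have "{w \<in> ext M W. w \<in> U \<and> w \<notin> V} = U - V"
    using def_subsets_subset[OF assms(1)] by blast
  ultimately show ?thesis by simp
qed

lemma def_subsets_top: "ext M W \<in> def_subsets L M W"
  by (auto simp: def_subsets_iff)

lemma def_subsets_Int:
  assumes "U \<in> def_subsets L M W" "V \<in> def_subsets L M W"
  shows "U \<inter> V \<in> def_subsets L M W"
  using def_subsets_Diff[OF assms(1) def_subsets_Diff[OF assms]] by (simp add: Diff_Diff_Int)

lemma def_subsets_Un:
  assumes "U \<in> def_subsets L M W" "V \<in> def_subsets L M W"
  shows "U \<union> V \<in> def_subsets L M W"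
proof -
  have "U \<union> V = ext M W - ((ext M W - U) \<inter> (ext M W - V))"
    using assms[THEN def_subsets_subset] by auto
  then show ?thesis
    using assms by (simp only: def_subsets_Diff def_subsets_Int def_subsets_top)
qed

lemma def_subsets_empty: "{} \<in> def_subsets L M W"
  using def_subsets_Diff[OF def_subsets_top def_subsets_top] by simp

lemma numeral_add: "numeral_of M (k + l) = add M (numeral_of M k) (numeral_of M l)"
  by (rule transfer_sentence[of "numeral_of N (k + l) = add N (numeral_of N k) (numeral_of N l)"],
      intro tr.D_intros) simp

end

subsection \<open>Counting\<close>

context true_arith
begin

text \<open>Subadditivity of finite cardinality; the doubled factor pays for having two
  sets.\<close>

lemma count_Un:
  "\<forall>k z u v w. (\<forall>a. memb M a z \<longrightarrow> memb M a u \<or> memb M a v) \<and>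
     lt M (mul M (add M k k) (mc u)) (mc w) \<and> lt M (mul M (add M k k) (mc v)) (mc w) \<longrightarrow>
     lt M (mul M k (mc z)) (mc w)"
proof (rule transfer_sentence[of "\<forall>k z u v w. (\<forall>a. memb N a z \<longrightarrow> memb N a u \<or> memb N a v) \<and>
     lt N (mul N (add N k k) (card (set_decode u))) (card (set_decode w)) \<and>
     lt N (mul N (add N k k) (card (set_decode v))) (card (set_decode w)) \<longrightarrow>
     lt N (mul N k (card (set_decode z))) (card (set_decode w))"], intro tr.D_intros T_mcard)
  have "k * card (set_decode z) < card (set_decode w)"
    if "set_decode z \<subseteq> set_decode u \<union> set_decode v"
      "(k + k) * card (set_decode u) < card (set_decode w)"
      "(k + k) * card (set_decode v) < card (set_decode w)" for k z u v w :: nat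
  proof -
    have "card (set_decode z) \<le> card (set_decode u \<union> set_decode v)"
      using that(1) by (intro card_mono) auto
    also have "\<dots> \<le> card (set_decode u) + card (set_decode v)" by (rule card_Un_le)
    finally have "k * card (set_decode z) \<le> k * (card (set_decode u) + card (set_decode v))"
      by (rule mult_le_mono2)
    then show ?thesis using that(2,3) by (simp add: algebra_simps)
  qed
  then show "\<forall>k z u v w. (\<forall>a. memb N a z \<longrightarrow> memb N a u \<or> memb N a v) \<and>
     lt N (mul N (add N k k) (card (set_decode u))) (card (set_decode w)) \<and>
     lt N (mul N (add N k k) (card (set_decode v))) (card (set_decode w)) \<longrightarrow>
     lt N (mul N k (card (set_decode z))) (card (set_decode w))"
    by (auto simp: subset_iff)
qed

lemma count_mono:
  "\<forall>k z u w. (\<forall>a. memb M a z \<longrightarrow> memb M a u) \<and> lt M (mul M k (mc u)) (mc w) \<longrightarrow>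
     lt M (mul M k (mc z)) (mc w)"
proof (rule transfer_sentence[of "\<forall>k z u w. (\<forall>a. memb N a z \<longrightarrow> memb N a u) \<and>
     lt N (mul N k (card (set_decode u))) (card (set_decode w)) \<longrightarrow>
     lt N (mul N k (card (set_decode z))) (card (set_decode w))"], intro tr.D_intros T_mcard)
  have "k * card (set_decode z) < card (set_decode w)"
    if "set_decode z \<subseteq> set_decode u" "k * card (set_decode u) < card (set_decode w)"
    for k z u w :: nat
    using mult_le_mono2[OF card_mono[OF finite_set_decode that(1)], of k] that(2) by linarith
  then show "\<forall>k z u w. (\<forall>a. memb N a z \<longrightarrow> memb N a u) \<and>
     lt N (mul N k (card (set_decode u))) (card (set_decode w)) \<longrightarrow>
     lt N (mul N k (card (set_decode z))) (card (set_decode w))"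
    by (auto simp: subset_iff)
qed

text \<open>Cardinalities of disjoint sets add up: a set of measure at least \<open>j/k\<close>
  extended by a disjoint one of measure at least \<open>1/k\<close> reaches
  \<open>(j + 1)/k\<close>.\<close>

lemma count_step:
  "\<forall>j k z u d w. (\<forall>a. memb M a u \<or> memb M a d \<longrightarrow> memb M a z) \<and> (\<forall>a. \<not> (memb M a u \<and> memb M a d)) \<and>
     \<not> lt M (mul M k (mc u)) (mul M j (mc w)) \<and> \<not> lt M (mul M k (mc d)) (mc w) \<longrightarrow>
     \<not> lt M (mul M k (mc z)) (mul M (add M j (one M)) (mc w))"
proof (rule transfer_sentence[of "\<forall>j k z u d w. (\<forall>a. memb N a u \<or> memb N a d \<longrightarrow> memb N a z) \<and>
     (\<forall>a. \<not> (memb N a u \<and> memb N a d)) \<and>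
     \<not> lt N (mul N k (card (set_decode u))) (mul N j (card (set_decode w))) \<and>
     \<not> lt N (mul N k (card (set_decode d))) (card (set_decode w)) \<longrightarrow>
     \<not> lt N (mul N k (card (set_decode z))) (mul N (add N j (one N)) (card (set_decode w)))"],
     intro tr.D_intros T_mcard)
  have "(j + 1) * card (set_decode w) \<le> k * card (set_decode z)"
    if "set_decode u \<union> set_decode d \<subseteq> set_decode z" "set_decode u \<inter> set_decode d = {}"
      "j * card (set_decode w) \<le> k * card (set_decode u)"
      "card (set_decode w) \<le> k * card (set_decode d)" for j k z u d w :: nat
  proof -
    have "card (set_decode u) + card (set_decode d) = card (set_decode u \<union> set_decode d)"
      using that(2) by (simp add: card_Un_disjoint)
    also have "\<dots> \<le> card (set_decode z)" using that(1) by (intro card_mono) auto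
    finally have "k * (card (set_decode u) + card (set_decode d)) \<le> k * card (set_decode z)"
      by (rule mult_le_mono2)
    then show ?thesis using that(3,4) by (simp add: algebra_simps)
  qed
  then show "\<forall>j k z u d w. (\<forall>a. memb N a u \<or> memb N a d \<longrightarrow> memb N a z) \<and>
     (\<forall>a. \<not> (memb N a u \<and> memb N a d)) \<and>
     \<not> lt N (mul N k (card (set_decode u))) (mul N j (card (set_decode w))) \<and>
     \<not> lt N (mul N k (card (set_decode d))) (card (set_decode w)) \<longrightarrow>
     \<not> lt N (mul N k (card (set_decode z))) (mul N (add N j (one N)) (card (set_decode w)))"
    unfolding memb_N std_simps not_less by blast
qed

text \<open>This stops the iteration of \<open>count_step\<close>: no subset of a nonempty set has
  relative measure \<open>(k + 1)/k\<close>.\<close>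

lemma count_bound:
  "\<forall>k u w. (\<forall>a. memb M a u \<longrightarrow> memb M a w) \<and> (\<exists>a. memb M a w) \<longrightarrow>
     lt M (mul M k (mc u)) (mul M (add M k (one M)) (mc w))"
proof (rule transfer_sentence[of "\<forall>k u w. (\<forall>a. memb N a u \<longrightarrow> memb N a w) \<and> (\<exists>a. memb N a w) \<longrightarrow>
     lt N (mul N k (card (set_decode u))) (mul N (add N k (one N)) (card (set_decode w)))"],
     intro tr.D_intros T_mcard)
  have "k * card (set_decode u) < (k + 1) * card (set_decode w)"
    if "set_decode u \<subseteq> set_decode w" "set_decode w \<noteq> {}" for k u w :: nat
  proof -
    have "card (set_decode w) > 0" using that(2) by (simp add: card_gt_0_iff)
    then show ?thesis
      using mult_le_mono2[OF card_mono[OF finite_set_decode that(1)], of k]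
      unfolding add_mult_distrib by linarith
  qed
  then show "\<forall>k u w. (\<forall>a. memb N a u \<longrightarrow> memb N a w) \<and> (\<exists>a. memb N a w) \<longrightarrow>
     lt N (mul N k (card (set_decode u))) (mul N (add N k (one N)) (card (set_decode w)))"
    unfolding memb_N std_simps by blast
qed

lemma count_zero: "\<forall>m n. \<not> lt M m (mul M (zer M) n)"
  by (rule transfer_sentence[of "\<forall>m n. \<not> lt N m (mul N (zer N) n)"], intro tr.D_intros) simp

lemma count_empty:
  "\<forall>k u w. (\<forall>a. \<not> memb M a u) \<and> (\<exists>a. memb M a w) \<longrightarrow> lt M (mul M k (mc u)) (mc w)"
proof (rule transfer_sentence[of "\<forall>k u w. (\<forall>a. \<not> memb N a u) \<and> (\<exists>a. memb N a w) \<longrightarrow>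
    lt N (mul N k (card (set_decode u))) (card (set_decode w))"], intro tr.D_intros T_mcard)
  have "k * card (set_decode u) < card (set_decode w)"
    if "set_decode u = {}" "set_decode w \<noteq> {}" for k u w :: nat
    using that by (simp add: card_gt_0_iff)
  then show "\<forall>k u w. (\<forall>a. \<not> memb N a u) \<and> (\<exists>a. memb N a w) \<longrightarrow>
    lt N (mul N k (card (set_decode u))) (card (set_decode w))"
    unfolding memb_N std_simps by blast
qed

end

subsection \<open>The quotient by the ideal of infinitesimal sets\<close>

locale sample_space = true_arith L N M for L :: lang and N :: "nat struc" and M :: "'m struc" +
  fixes W :: 'm
  assumes nonempty: "ext M W \<noteq> {}"
begin

abbreviation DS :: "'m set set" where "DS \<equiv> def_subsets L M W"

abbreviation \<I> :: "'m set set" where "\<I> \<equiv> inf_ideal L M W"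

text \<open>The ideal is given by infinitely many conditions, one for each standard
  \<open>k\<close>. Each of them is first-order by itself, so saturation can deal with them one at a
  time.\<close>

definition small :: "nat \<Rightarrow> 'm set \<Rightarrow> bool" where
  "small k U \<longleftrightarrow> lt M (mul M (numeral_of M k) (mcard M U)) (mcard M (ext M W))"

lemma ideal_iff: "U \<in> \<I> \<longleftrightarrow> U \<in> DS \<and> (\<forall>k\<ge>1. small k U)"
  by (simp add: inf_ideal_def small_def)

lemma small_Un:
  assumes "Z \<in> DS" "U \<in> DS" "V \<in> DS" "Z \<subseteq> U \<union> V" "small (k + k) U" "small (k + k) V"
  shows "small k Z"
proof -
  obtain z u v where "ext M z = Z" "ext M u = U" "ext M v = V" using assms(1-3) by (metis def_subsetsE)
  moreover from this have "\<forall>a. memb M a z \<longrightarrow> memb M a u \<or> memb M a v"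
    using assms(4) by (auto simp flip: mem_ext)
  ultimately show ?thesis
    using count_Un[rule_format, of z u v "numeral_of M k" W] assms(5,6)
    by (simp add: small_def numeral_add)
qed

lemma small_mono:
  assumes "Z \<in> DS" "U \<in> DS" "Z \<subseteq> U" "small k U"
  shows "small k Z"
proof -
  obtain z u where "ext M z = Z" "ext M u = U" using assms(1-2) by (metis def_subsetsE)
  moreover from this have "\<forall>a. memb M a z \<longrightarrow> memb M a u"
    using assms(3) by (auto simp flip: mem_ext)
  ultimately show ?thesis
    using count_mono[rule_format, of z u "numeral_of M k" W] assms(4)
    by (simp add: small_def)
qed

lemma small_empty: "small k {}"
proof -
  obtain u where "ext M u = {}" using def_subsets_empty by (metis def_subsetsE)
  moreover from this have "(\<forall>a. \<not> memb M a u) \<and> (\<exists>a. memb M a W)"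
    using nonempty by (auto simp flip: mem_ext)
  ultimately show ?thesis
    using count_empty[rule_format, of u W "numeral_of M k"] by (simp add: small_def)
qed

text \<open>
  Otherwise every member of \<open>\<C>\<close> could be enlarged within \<open>\<C>\<close> by at least \<open>|\<Omega>|/k\<close>, and after
  \<open>k + 1\<close> enlargements it would exceed \<open>\<Omega>\<close>.
\<close>

lemma directed_almost_max:
  assumes "\<C> \<noteq> {}" "\<C> \<subseteq> DS" and dir: "\<And>U V. U \<in> \<C> \<Longrightarrow> V \<in> \<C> \<Longrightarrow> \<exists>T\<in>\<C>. U \<union> V \<subseteq> T"
  shows "\<exists>U\<in>\<C>. \<forall>V\<in>\<C>. small k (V - U)"
proof (rule ccontr)
  assume "\<not> ?thesis"
  then have jump: "\<And>U. U \<in> \<C> \<Longrightarrow> \<exists>V\<in>\<C>. \<not> small k (V - U)" by blast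
  \<comment> \<open>\<open>?ge j U\<close> is \<open>k|U| \<ge> j|\<Omega>|\<close>, put as a
    negation because \<open>lt\<close> is the order relation of the language.\<close>
  let ?ge = "\<lambda>j U. \<not> lt M (mul M (numeral_of M k) (mcard M U)) (mul M (numeral_of M j) (mcard M (ext M W)))"
  have "\<exists>U\<in>\<C>. ?ge j U" for j
  proof (induction j)
    case 0
    then show ?case using \<open>\<C> \<noteq> {}\<close> count_zero by auto
  next
    case (Suc j)
    then obtain U where U: "U \<in> \<C>" "?ge j U" by blast
    obtain V where V: "V \<in> \<C>" "\<not> small k (V - U)" using jump[OF U(1)] by blast
    obtain T where T: "T \<in> \<C>" "U \<union> V \<subseteq> T" using dir[OF U(1) V(1)] by blast
    have "U \<in> DS" "V - U \<in> DS" "T \<in> DS" using U V T assms(2) by (auto intro: def_subsets_Diff)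
    then obtain u d t where "ext M u = U" "ext M d = V - U" "ext M t = T" by (metis def_subsetsE)
    then have "?ge (Suc j) T"
      using count_step[rule_format, of u d t "numeral_of M k" "numeral_of M j" W] U V T
      by (auto simp: small_def mem_ext[symmetric])
    then show ?case using T by blast
  qed
  then obtain U where U: "U \<in> \<C>" "?ge (Suc k) U" by blast
  obtain u where "ext M u = U" "ext M u \<subseteq> ext M W" using U(1) assms(2) by (meson def_subsetsE subsetD)
  then show False
    using U(2) nonempty count_bound[rule_format, of u W "numeral_of M k"]
    by (auto simp: mem_ext[symmetric])
qed

lemma ideal_empty: "{} \<in> \<I>"
  by (simp add: ideal_iff small_empty def_subsets_empty)

lemma ideal_mono: "U \<in> \<I> \<Longrightarrow> Z \<in> DS \<Longrightarrow> Z \<subseteq> U \<Longrightarrow> Z \<in> \<I>"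
  using small_mono unfolding ideal_iff by blast

lemma ideal_Un:
  assumes "U \<in> \<I>" "V \<in> \<I>"
  shows "U \<union> V \<in> \<I>"
proof -
  have "small k (U \<union> V)" if "k \<ge> 1" for k
    by (rule small_Un[of _ U V]) (use assms that in \<open>auto simp: ideal_iff intro: def_subsets_Un\<close>)
  then show ?thesis using assms by (simp add: ideal_iff def_subsets_Un)
qed

lemma ideal_subset_Un: "U \<in> \<I> \<Longrightarrow> V \<in> \<I> \<Longrightarrow> Z \<in> DS \<Longrightarrow> Z \<subseteq> U \<union> V \<Longrightarrow> Z \<in> \<I>"
  using ideal_mono[OF ideal_Un] .

lemma ideal_rel_iff:
  "(U, V) \<in> ideal_rel L M W \<longleftrightarrow> U \<in> DS \<and> V \<in> DS \<and> U - V \<in> \<I> \<and> V - U \<in> \<I>"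
proof -
  have "(U - V) \<union> (V - U) \<in> \<I> \<longleftrightarrow> U - V \<in> \<I> \<and> V - U \<in> \<I>" if "U \<in> DS" "V \<in> DS"
    using that ideal_Un[of "U - V" "V - U"] ideal_mono[of "(U - V) \<union> (V - U)" "U - V"]
      ideal_mono[of "(U - V) \<union> (V - U)" "V - U"] def_subsets_Diff by blast
  then show ?thesis unfolding ideal_rel_def by blast
qed

lemma ideal_trans:
  assumes "U \<in> DS" "V \<in> DS" "T \<in> DS" "U - V \<in> \<I>" "V - T \<in> \<I>"
  shows "U - T \<in> \<I>"
  by (rule ideal_subset_Un[OF assms(4,5)]) (use assms in \<open>auto intro: def_subsets_Diff\<close>)

lemma equiv_ideal_rel: "equiv DS (ideal_rel L M W)"
proof (rule equivI)
  show "ideal_rel L M W \<subseteq> DS \<times> DS" by (auto simp: ideal_rel_iff)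
  show "refl_on DS (ideal_rel L M W)"
    by (auto simp: refl_on_def ideal_rel_iff ideal_empty)
  show "sym (ideal_rel L M W)" by (auto simp: sym_def ideal_rel_iff)
  show "trans (ideal_rel L M W)"
    unfolding trans_def ideal_rel_iff using ideal_trans by blast
qed

section \<open>Order, bounds and Boolean operations on classes\<close>

abbreviation cls :: "'m set \<Rightarrow> 'm set set" where "cls \<equiv> quot_class L M W"

lemma carrier_iff: "X \<in> carrier (BA L M W) \<longleftrightarrow> (\<exists>U\<in>DS. X = cls U)"
  by (auto simp: BA_def quot_class_def quotient_def)

lemma mem_cls: "V \<in> cls U \<longleftrightarrow> U \<in> DS \<and> V \<in> DS \<and> U - V \<in> \<I> \<and> V - U \<in> \<I>"
  by (simp add: quot_class_def ideal_rel_iff)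

lemma cls_eq: "U \<in> DS \<Longrightarrow> V \<in> DS \<Longrightarrow> cls U = cls V \<longleftrightarrow> U - V \<in> \<I> \<and> V - U \<in> \<I>"
  unfolding quot_class_def using eq_equiv_class_iff[OF equiv_ideal_rel] ideal_rel_iff by blast

text \<open>The order is defined by some representatives; two applications of
  \<open>ideal_trans\<close> pass from them to the given ones.\<close>

lemma le_cls:
  assumes "U \<in> DS" "V \<in> DS"
  shows "cls U \<sqsubseteq>\<^bsub>BA L M W\<^esub> cls V \<longleftrightarrow> U - V \<in> \<I>"
proof
  assume "cls U \<sqsubseteq>\<^bsub>BA L M W\<^esub> cls V"
  then obtain U' V' where "U' \<in> cls U" "V' \<in> cls V" "U' - V' \<in> \<I>" by (auto simp: BA_def)
  then show "U - V \<in> \<I>" using ideal_trans[of U U' V'] ideal_trans[of U V' V] by (auto simp: mem_cls)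
next
  assume "U - V \<in> \<I>"
  moreover have "U \<in> cls U" "V \<in> cls V" using assms by (auto simp: mem_cls ideal_empty)
  ultimately show "cls U \<sqsubseteq>\<^bsub>BA L M W\<^esub> cls V" by (auto simp: BA_def)
qed

text \<open>\<open>inf\<close> chooses some greatest lower bound. Besides showing that
  \<open>cls G\<close> is one, it is therefore necessary to show that there is no other, which is
  antisymmetry modulo the ideal.\<close>

lemma Inf_cls:
  assumes S: "\<S> \<subseteq> DS" and G: "G \<in> DS" "\<And>S. S \<in> \<S> \<Longrightarrow> G - S \<in> \<I>"
    and greatest: "\<And>T. T \<in> DS \<Longrightarrow> (\<And>S. S \<in> \<S> \<Longrightarrow> T - S \<in> \<I>) \<Longrightarrow> T - G \<in> \<I>"
  shows "\<Sqinter>\<^bsub>BA L M W\<^esub> (cls ` \<S>) = cls G"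
proof -
  have lower: "cls T \<in> Lower (BA L M W) (cls ` \<S>) \<longleftrightarrow> (\<forall>S\<in>\<S>. T - S \<in> \<I>)" if "T \<in> DS" for T
  proof -
    have "cls ` \<S> \<subseteq> carrier (BA L M W)" "cls T \<in> carrier (BA L M W)"
      using S that carrier_iff by blast+
    then have "cls T \<in> Lower (BA L M W) (cls ` \<S>) \<longleftrightarrow> (\<forall>X\<in>cls ` \<S>. cls T \<sqsubseteq>\<^bsub>BA L M W\<^esub> X)"
      unfolding Lower_def by (simp add: Int_absorb2 Ball_def)
    moreover have "S \<in> \<S> \<Longrightarrow> S \<in> DS" for S using S by blast
    ultimately show ?thesis by (simp add: le_cls[OF that])
  qed
  have Lower_carrier: "Lower (BA L M W) (cls ` \<S>) \<subseteq> carrier (BA L M W)"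
    by (auto simp: Lower_def)
  have "greatest (BA L M W) (cls G) (Lower (BA L M W) (cls ` \<S>))"
    unfolding greatest_def
  proof (intro conjI ballI Lower_carrier)
    show "cls G \<in> Lower (BA L M W) (cls ` \<S>)" using G by (simp add: lower)
    fix X assume X: "X \<in> Lower (BA L M W) (cls ` \<S>)"
    then obtain T where T: "T \<in> DS" "X = cls T" using Lower_carrier carrier_iff by blast
    then show "X \<sqsubseteq>\<^bsub>BA L M W\<^esub> cls G" using X G(1) by (simp add: lower le_cls greatest)
  qed
  moreover have "X = cls G" if "greatest (BA L M W) X (Lower (BA L M W) (cls ` \<S>))" for X
  proof -
    have X: "X \<in> Lower (BA L M W) (cls ` \<S>)"
      and "\<forall>Y\<in>Lower (BA L M W) (cls ` \<S>). Y \<sqsubseteq>\<^bsub>BA L M W\<^esub> X"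
      using that by (simp_all add: greatest_def)
    then have XG: "cls G \<sqsubseteq>\<^bsub>BA L M W\<^esub> X" using G by (simp add: lower)
    obtain T where T: "T \<in> DS" "X = cls T"
      using subsetD[OF Lower_carrier X] unfolding carrier_iff by blast
    have "T - G \<in> \<I>" using X T(1) greatest unfolding T(2) by (simp add: lower)
    moreover have "G - T \<in> \<I>" using XG T(1) G(1) unfolding T(2) by (simp add: le_cls)
    ultimately show ?thesis using T G(1) by (simp add: cls_eq)
  qed
  ultimately show ?thesis unfolding inf_def by (rule some_equality)
qed

lemma Sup_cls:
  assumes S: "\<S> \<subseteq> DS" and G: "G \<in> DS" "\<And>S. S \<in> \<S> \<Longrightarrow> S - G \<in> \<I>"
    and least: "\<And>T. T \<in> DS \<Longrightarrow> (\<And>S. S \<in> \<S> \<Longrightarrow> S - T \<in> \<I>) \<Longrightarrow> G - T \<in> \<I>"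
  shows "\<Squnion>\<^bsub>BA L M W\<^esub> (cls ` \<S>) = cls G"
proof -
  have upper: "cls T \<in> Upper (BA L M W) (cls ` \<S>) \<longleftrightarrow> (\<forall>S\<in>\<S>. S - T \<in> \<I>)" if "T \<in> DS" for T
  proof -
    have "cls ` \<S> \<subseteq> carrier (BA L M W)" "cls T \<in> carrier (BA L M W)"
      using S that carrier_iff by blast+
    then have "cls T \<in> Upper (BA L M W) (cls ` \<S>) \<longleftrightarrow> (\<forall>X\<in>cls ` \<S>. X \<sqsubseteq>\<^bsub>BA L M W\<^esub> cls T)"
      unfolding Upper_def by (simp add: Int_absorb2 Ball_def)
    moreover have "S \<in> \<S> \<Longrightarrow> S \<in> DS" for S using S by blast
    ultimately show ?thesis by (simp add: le_cls[OF _ that])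
  qed
  have Upper_carrier: "Upper (BA L M W) (cls ` \<S>) \<subseteq> carrier (BA L M W)"
    by (auto simp: Upper_def)
  have "least (BA L M W) (cls G) (Upper (BA L M W) (cls ` \<S>))"
    unfolding least_def
  proof (intro conjI ballI Upper_carrier)
    show "cls G \<in> Upper (BA L M W) (cls ` \<S>)" using G by (simp add: upper)
    fix X assume X: "X \<in> Upper (BA L M W) (cls ` \<S>)"
    then obtain T where T: "T \<in> DS" "X = cls T" using Upper_carrier carrier_iff by blast
    then show "cls G \<sqsubseteq>\<^bsub>BA L M W\<^esub> X" using X G(1) by (simp add: upper le_cls least)
  qed
  moreover have "X = cls G" if "least (BA L M W) X (Upper (BA L M W) (cls ` \<S>))" for X
  proof -
    have X: "X \<in> Upper (BA L M W) (cls ` \<S>)"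
      and "\<forall>Y\<in>Upper (BA L M W) (cls ` \<S>). X \<sqsubseteq>\<^bsub>BA L M W\<^esub> Y"
      using that by (simp_all add: least_def)
    then have XG: "X \<sqsubseteq>\<^bsub>BA L M W\<^esub> cls G" using G by (simp add: upper)
    obtain T where T: "T \<in> DS" "X = cls T"
      using subsetD[OF Upper_carrier X] unfolding carrier_iff by blast
    have "G - T \<in> \<I>" using X T(1) least unfolding T(2) by (simp add: upper)
    moreover have "T - G \<in> \<I>" using XG T(1) G(1) unfolding T(2) by (simp add: le_cls)
    ultimately show ?thesis using T G(1) by (simp add: cls_eq)
  qed
  ultimately show ?thesis unfolding sup_def by (rule some_equality)
qed

lemma meet_cls:
  assumes "U \<in> DS" "V \<in> DS"
  shows "cls U \<sqinter>\<^bsub>BA L M W\<^esub> cls V = cls (U \<inter> V)"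
proof -
  have "\<Sqinter>\<^bsub>BA L M W\<^esub> (cls ` {U, V}) = cls (U \<inter> V)"
  proof (rule Inf_cls)
    fix T assume T: "T \<in> DS" "\<And>S. S \<in> {U, V} \<Longrightarrow> T - S \<in> \<I>"
    show "T - U \<inter> V \<in> \<I>"
      by (rule ideal_subset_Un[of "T - U" "T - V"])
        (use T assms in \<open>auto intro: def_subsets_Diff def_subsets_Int\<close>)
  next
    fix S assume "S \<in> {U, V}"
    then have "U \<inter> V - S = {}" by blast
    then show "U \<inter> V - S \<in> \<I>" by (simp only: ideal_empty)
  qed (use assms in \<open>auto intro: def_subsets_Int\<close>)
  then show ?thesis by (simp add: meet_def)
qed

lemma join_cls:
  assumes "U \<in> DS" "V \<in> DS"
  shows "cls U \<squnion>\<^bsub>BA L M W\<^esub> cls V = cls (U \<union> V)"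
proof -
  have "\<Squnion>\<^bsub>BA L M W\<^esub> (cls ` {U, V}) = cls (U \<union> V)"
  proof (rule Sup_cls)
    fix T assume T: "T \<in> DS" "\<And>S. S \<in> {U, V} \<Longrightarrow> S - T \<in> \<I>"
    show "U \<union> V - T \<in> \<I>"
      by (rule ideal_subset_Un[of "U - T" "V - T"])
        (use T assms in \<open>auto intro: def_subsets_Diff def_subsets_Un\<close>)
  next
    fix S assume "S \<in> {U, V}"
    then have "S - (U \<union> V) = {}" by blast
    then show "S - (U \<union> V) \<in> \<I>" by (simp only: ideal_empty)
  qed (use assms in \<open>auto intro: def_subsets_Un\<close>)
  then show ?thesis by (simp add: join_def)
qed

text \<open>Complementation in \<Omega> exchanges the two parts of a symmetric difference, hence
  maps a class into a class; being an involution, it maps onto it.\<close>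

lemma compl_cls:
  assumes "U \<in> DS"
  shows "BA_compl M W (cls U) = cls (ext M W - U)"
proof (intro subset_antisym subsetI)
  fix X assume "X \<in> BA_compl M W (cls U)"
  then obtain V where V: "V \<in> cls U" "X = ext M W - V" by (auto simp: BA_compl_def)
  then have "ext M W - U - X = V - U" "X - (ext M W - U) = U - V"
    using def_subsets_subset[OF assms] def_subsets_subset[of V] by (auto simp: mem_cls)
  then show "X \<in> cls (ext M W - U)"
    using V by (auto simp: mem_cls intro: def_subsets_Diff def_subsets_top)
next
  fix X assume X: "X \<in> cls (ext M W - U)"
  then have sub: "X \<subseteq> ext M W" using def_subsets_subset by (auto simp: mem_cls)
  then have "U - (ext M W - X) = X - (ext M W - U)" "(ext M W - X) - U = ext M W - U - X"
    using def_subsets_subset[OF assms] by auto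
  then have "ext M W - X \<in> cls U"
    using X assms by (auto simp: mem_cls intro: def_subsets_Diff def_subsets_top)
  then show "X \<in> BA_compl M W (cls U)"
    unfolding BA_compl_def using double_diff[OF sub subset_refl] by (metis imageI)
qed

end

subsection \<open>Countable infima\<close>

lemma finite_directed_bound:
  assumes "\<C> \<noteq> {}" and dir: "\<And>U V. U \<in> \<C> \<Longrightarrow> V \<in> \<C> \<Longrightarrow> \<exists>T\<in>\<C>. U \<union> V \<subseteq> T"
  shows "finite \<G> \<Longrightarrow> \<G> \<subseteq> \<C> \<Longrightarrow> \<exists>T\<in>\<C>. \<Union>\<G> \<subseteq> T"
proof (induction \<G> rule: finite_induct)
  case empty
  then show ?case using \<open>\<C> \<noteq> {}\<close> by auto
next
  case (insert U \<G>)
  then obtain T where T: "T \<in> \<C>" "\<Union>\<G> \<subseteq> T" by auto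
  obtain T' where "T' \<in> \<C>" "U \<union> T \<subseteq> T'" using dir[of U T] insert.prems T by auto
  then show ?case using T by (intro bexI[of _ T']) auto
qed

lemma Conj_list:
  assumes "finite \<Phi>"
  obtains As where "set As = \<Phi>" "Conj \<Phi> = foldr And As Top"
proof -
  have "\<exists>As. distinct As \<and> set As = \<Phi>" using finite_distinct_list[OF assms] by blast
  from someI_ex[OF this] show ?thesis using that unfolding Conj_def by blast
qed

lemma sat_Conj:
  assumes "finite \<Phi>"
  shows "sat M i e (Conj \<Phi>) \<longleftrightarrow> (\<forall>A\<in>\<Phi>. sat M i e A)"
proof -
  obtain As where As: "set As = \<Phi>" "Conj \<Phi> = foldr And As Top" using Conj_list[OF assms] .
  have "sat M i e (foldr And As Top) \<longleftrightarrow> (\<forall>A\<in>set As. sat M i e A)" by (induction As) auto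
  then show ?thesis using As by simp
qed

lemma open_Conj:
  assumes "finite \<Phi>" "\<forall>A\<in>\<Phi>. open_fm A \<and> wf_fm L C A \<and> fv A \<subseteq> X"
  shows "open_fm (Conj \<Phi>)" "wf_fm L C (Conj \<Phi>)" "fv (Conj \<Phi>) \<subseteq> X"
proof -
  obtain As where As: "set As = \<Phi>" "Conj \<Phi> = foldr And As Top" using Conj_list[OF assms(1)] .
  have "(\<forall>A\<in>set As. open_fm A \<and> wf_fm L C A \<and> fv A \<subseteq> X) \<Longrightarrow>
    open_fm (foldr And As Top) \<and> wf_fm L C (foldr And As Top) \<and> fv (foldr And As Top) \<subseteq> X"
    by (induction As) auto
  then show "open_fm (Conj \<Phi>)" "wf_fm L C (Conj \<Phi>)" "fv (Conj \<Phi>) \<subseteq> X"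
    using As assms(2) by auto
qed

context sample_space
begin

lemma DS_UN:
  "finite I \<Longrightarrow> (\<And>i. i \<in> I \<Longrightarrow> U i \<in> DS) \<Longrightarrow> (\<Union>i\<in>I. U i) \<in> DS"
  by (induction I rule: finite_induct) (auto intro: def_subsets_Un def_subsets_empty)

lemma ideal_UN:
  "finite I \<Longrightarrow> (\<And>i. i \<in> I \<Longrightarrow> U i \<in> \<I>) \<Longrightarrow> (\<Union>i\<in>I. U i) \<in> \<I>"
  by (induction I rule: finite_induct) (auto intro: ideal_Un ideal_empty)

lemma coded_Diff:
  obtains z where "ext M z = ext M u - ext M a"
proof -
  have "Def (\<lambda>e. \<not> memb M (e 0) a)" by (intro Def_intros)
  from comprehension[OF this, of u] obtain z where "ext M z = {w \<in> ext M u. \<not> memb M w a}" .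
  moreover have "{w \<in> ext M u. \<not> memb M w a} = ext M u - ext M a" by (auto simp flip: mem_ext)
  ultimately have "ext M z = ext M u - ext M a" by simp
  then show ?thesis by (rule that)
qed

lemma Def_subset: "Def (\<lambda>e. ext M (e 0) \<subseteq> ext M u)"
  unfolding subset_iff mem_ext by (intro Def_intros)

text \<open>The difference enters through its codes \<open>z\<close>. One exists by
  \<open>coded_Diff\<close>, and all codes have the same extension, so quantifying over them does
  not change the condition.\<close>

lemma Def_small_Diff: "Def (\<lambda>e. small k (ext M u - ext M (e 0)))"
proof -
  have "small k (ext M u - ext M a) \<longleftrightarrow>
      (\<forall>z. (\<forall>w. memb M w z \<longleftrightarrow> memb M w u \<and> \<not> memb M w a) \<longrightarrow>
         lt M (mul M (numeral_of M k) (mc z)) (mc W))" for a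
  proof -
    obtain z where z: "ext M z = ext M u - ext M a" by (rule coded_Diff)
    have "(\<forall>w. memb M w y \<longleftrightarrow> memb M w u \<and> \<not> memb M w a) \<longleftrightarrow> ext M y = ext M z" for y
      unfolding z by (simp add: set_eq_iff mem_ext)
    then show ?thesis unfolding small_def z[symmetric] by auto
  qed
  moreover have "Def (\<lambda>e. \<forall>z. (\<forall>w. memb M w z \<longleftrightarrow> memb M w u \<and> \<not> memb M w (e 0)) \<longrightarrow>
         lt M (mul M (numeral_of M k) (mc z)) (mc W))"
    by (intro Def_intros)
  ultimately show ?thesis by simp
qed

text \<open>Finite intersections decrease, and some of them come within \<open>1/k\<close> of all
  further ones. Saturation yields a set inside every member of \<open>\<S>\<close> that misses less
  than \<open>1/k\<close> of each of these; a lower bound modulo the ideal can then exceed it only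
  by an infinitesimal set. The inclusions in the members hold exactly, not just modulo the
  ideal.\<close>

lemma countable_infimum:
  assumes sat: "aleph1_saturated L M" and "countable \<S>" "\<S> \<subseteq> DS"
  obtains G where "G \<in> DS" "\<Sqinter>\<^bsub>BA L M W\<^esub> (cls ` \<S>) = cls G" "\<forall>S\<in>\<S>. G \<subseteq> S"
    "\<forall>T\<in>DS. (\<forall>S\<in>\<S>. T - S \<in> \<I>) \<longrightarrow> T - G \<in> \<I>"
proof -
  define co where "co \<F> = (\<Union>S\<in>\<F>. ext M W - S)" for \<F>
  have S_DS: "S \<in> DS" if "S \<in> \<S>" for S using that assms(3) by blast
  have co_DS: "co \<F> \<in> DS" if "finite \<F>" "\<F> \<subseteq> \<S>" for \<F>
    unfolding co_def using that S_DS by (intro DS_UN def_subsets_Diff def_subsets_top) auto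
  define Fin where "Fin = {\<F>. finite \<F> \<and> \<F> \<subseteq> \<S>}"
  \<comment> \<open>Complements turn finite intersections into finite unions, and these are
    directed.\<close>
  have "\<exists>U\<in>co ` Fin. \<forall>V\<in>co ` Fin. small k (V - U)" for k
  proof (rule directed_almost_max)
    show "co ` Fin \<noteq> {}" by (auto simp: Fin_def)
    show "co ` Fin \<subseteq> DS" using co_DS by (auto simp: Fin_def)
    fix U V assume "U \<in> co ` Fin" "V \<in> co ` Fin"
    then obtain \<F> \<G> where "\<F> \<in> Fin" "U = co \<F>" "\<G> \<in> Fin" "V = co \<G>" by blast
    then have "\<F> \<union> \<G> \<in> Fin" "U \<union> V \<subseteq> co (\<F> \<union> \<G>)" by (auto simp: Fin_def co_def)
    then show "\<exists>T\<in>co ` Fin. U \<union> V \<subseteq> T" by blast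
  qed
  then have "\<forall>k. \<exists>\<F>\<in>Fin. \<forall>\<G>\<in>Fin. small k (co \<G> - co \<F>)" by simp
  then obtain \<F> where \<F>: "\<And>k. \<F> k \<in> Fin" "\<And>k \<G>. \<G> \<in> Fin \<Longrightarrow> small k (co \<G> - co (\<F> k))"
    by metis
  have F_DS: "ext M W - co (\<F> k) \<in> DS" for k
    using \<F>(1)[of k] co_DS by (intro def_subsets_Diff def_subsets_top) (auto simp: Fin_def)
  then have "\<forall>k. \<exists>u. ext M u = ext M W - co (\<F> k)" by (simp add: def_subsets_iff)
  then obtain u where u: "\<And>k. ext M (u k) = ext M W - co (\<F> k)" by metis
  define Sub where "Sub S a \<longleftrightarrow> ext M a \<subseteq> S" for S a
  define Near where "Near k a \<longleftrightarrow> small k (ext M (u k) - ext M a)" for k a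
  \<comment> \<open>Adding \<Omega> to \<open>\<S>\<close> keeps the set within \<Omega> even if
    \<open>\<S>\<close> is empty.\<close>
  have "\<exists>a. \<forall>Q\<in>Sub ` insert (ext M W) \<S> \<union> range Near. Q a"
  proof (rule saturation[OF sat])
    show "countable (Sub ` insert (ext M W) \<S> \<union> range Near)" using \<open>countable \<S>\<close> by simp
    fix Q assume "Q \<in> Sub ` insert (ext M W) \<S> \<union> range Near"
    then consider S where "S \<in> DS" "Q = Sub S" | k where "Q = Near k"
      using S_DS def_subsets_top by blast
    then show "Def (\<lambda>e. Q (e 0))"
    proof cases
      case 1
      then obtain s where "ext M s = S" by (auto elim: def_subsetsE)
      then show ?thesis using Def_subset[of s] 1 by (simp add: Sub_def)
    next
      case 2
      then show ?thesis by (simp add: Near_def Def_small_Diff)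
    qed
  next
    fix \<Q> assume \<Q>: "finite \<Q>" "\<Q> \<subseteq> Sub ` insert (ext M W) \<S> \<union> range Near"
    have "finite (\<Q> \<inter> Sub ` \<S>)" "\<Q> \<inter> Sub ` \<S> \<subseteq> Sub ` \<S>" using \<Q>(1) by auto
    from finite_subset_image[OF this] obtain \<G> where
      \<G>: "\<G> \<subseteq> \<S>" "finite \<G>" "\<Q> \<inter> Sub ` \<S> = Sub ` \<G>" by blast
    then have Fin: "\<G> \<in> Fin" by (simp add: Fin_def)
    have "ext M W - co \<G> \<in> DS"
      using \<G> co_DS by (intro def_subsets_Diff def_subsets_top) auto
    \<comment> \<open>The intersection over \<open>\<G>\<close> satisfies every
      \<open>Near k\<close>, because \<open>\<F> k\<close> is almost optimal against all finite
      subsets.\<close>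
    then obtain a where a: "ext M a = ext M W - co \<G>" by (auto elim: def_subsetsE)
    have "Sub (ext M W) a" by (simp add: Sub_def a)
    moreover have "Sub S a" if "S \<in> \<G>" for S
      using that by (auto simp: Sub_def a co_def)
    moreover have "Near k a" for k
    proof -
      have "ext M (u k) - ext M a = co \<G> - co (\<F> k)"
        unfolding u a using def_subsets_subset[OF co_DS] \<G> by blast
      then show ?thesis using \<F>(2)[OF Fin] by (simp add: Near_def)
    qed
    ultimately have "Q a" if "Q \<in> \<Q>" for Q
    proof -
      have "Q \<in> Sub ` insert (ext M W) \<S> \<union> range Near" using that \<Q>(2) by (rule subsetD[rotated])
      then consider "Q = Sub (ext M W)" | "Q \<in> Sub ` \<S>" | k where "Q = Near k"
        by (elim UnE imageE insertE) auto
      then show ?thesis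
      proof cases
        case 2
        then have "Q \<in> Sub ` \<G>" using that by (simp flip: \<G>(3))
        then show ?thesis using \<open>\<And>S. S \<in> \<G> \<Longrightarrow> Sub S a\<close> by (elim imageE) simp
      qed (simp_all add: \<open>Sub (ext M W) a\<close> \<open>\<And>k. Near k a\<close>)
    qed
    then show "\<exists>a. \<forall>Q\<in>\<Q>. Q a" by (intro exI[of _ a] ballI)
  qed
  then obtain a where "\<forall>Q\<in>Sub ` insert (ext M W) \<S> \<union> range Near. Q a" by (rule exE)
  then have a: "ext M a \<subseteq> ext M W" "\<And>S. S \<in> \<S> \<Longrightarrow> ext M a \<subseteq> S" "\<And>k. Near k a"
    unfolding Sub_def[symmetric] by (simp_all add: ball_Un)
  have a_DS: "ext M a \<in> DS" using a(1) by (auto simp: def_subsets_iff)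
  have greatest: "T - ext M a \<in> \<I>" if T: "T \<in> DS" "\<And>S. S \<in> \<S> \<Longrightarrow> T - S \<in> \<I>" for T
  proof -
    have "small k (T - ext M a)" if "k \<ge> 1" for k
    \<comment> \<open>Two errors below \<open>1/(2k)\<close>: the first is a finite union of
      infinitesimal sets, the second is bounded by \<open>Near (k + k)\<close>.\<close>
    proof (rule small_Un[of _ "T - ext M (u (k + k))" "ext M (u (k + k)) - ext M a"])
      have "(\<Union>S\<in>\<F> (k + k). T - S) \<in> \<I>"
        using T(2) \<F>(1)[of "k + k"] by (intro ideal_UN) (auto simp: Fin_def)
      moreover have "T - ext M (u (k + k)) = (\<Union>S\<in>\<F> (k + k). T - S)"
        unfolding u co_def using def_subsets_subset[OF T(1)] by blast
      ultimately have "T - ext M (u (k + k)) \<in> \<I>" by simp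
      then show "small (k + k) (T - ext M (u (k + k)))" using that by (simp add: ideal_iff)
      show "small (k + k) (ext M (u (k + k)) - ext M a)" using a(3) by (simp add: Near_def)
    qed (use T(1) a_DS F_DS u in \<open>auto intro: def_subsets_Diff\<close>)
    then show ?thesis using T(1) a_DS by (simp add: ideal_iff def_subsets_Diff)
  qed
  have "ext M a - S \<in> \<I>" if "S \<in> \<S>" for S
  proof -
    have "ext M a - S = {}" using a(2)[OF that] by blast
    then show ?thesis by (simp only: ideal_empty)
  qed
  then have "\<Sqinter>\<^bsub>BA L M W\<^esub> (cls ` \<S>) = cls (ext M a)"
    by (rule Inf_cls[OF assms(3) a_DS _ greatest])
  then show ?thesis using a(2) greatest by (intro that[OF a_DS]) simp_all
qed

section \<open>Truth sets of formulas\<close>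

text \<open>Every variable gets the value \<open>y(w)\<close>, so the name of the free variable need
  not be carried along. With \<open>app_tot\<close> the condition is definable for all
  \<open>y\<close> in \<open>M\<close>, whether or not they code functions.\<close>

definition holds :: "'m \<Rightarrow> 'm \<Rightarrow> 'm fm \<Rightarrow> bool" where
  "holds y w B \<longleftrightarrow> sat M (\<lambda>\<delta>. app_tot M \<delta> w) (\<lambda>_. app_tot M y w) B"

definition truth_set :: "'m \<Rightarrow> 'm fm \<Rightarrow> 'm set" where
  "truth_set y B = {w \<in> ext M W. holds y w B}"

text \<open>The interpretation of the constants varies with \<open>w\<close>. They are therefore
  eliminated, and the variables replacing them are substituted by applications to
  \<open>w\<close>.\<close>

lemma Def_holds:
  assumes "wf_fm L C B"
  shows "DefT f \<Longrightarrow> DefT g \<Longrightarrow> Def (\<lambda>e. holds (f e) (g e) B)"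
proof (rule df.D_subst2[of "\<lambda>y w. holds y w B"])
  obtain B' :: "'m fm" and c where B': "wf_fm L {} B'"
    and sat_B': "\<And>(M :: 'm struc) i j e. sat M j (\<lambda>n. if even n then e (n div 2) else i (c (n div 2))) B' = sat M i e B"
    using constant_elimination[OF assms, where 'd = 'm and 'm = 'm] by blast
  define \<sigma> where "\<sigma> n e = (if even n then app_tot M (e 0) (e 1) else app_tot M (c (n div 2)) (e 1))"
    for n :: nat and e :: "nat \<Rightarrow> 'm"
  have \<sigma>: "DefT (\<sigma> n)" for n
    unfolding \<sigma>_def by (cases "even n") (simp_all only: if_True if_False, intro Def_intros, intro Def_intros)
  have "wf_fm L UNIV B'" using B' wf_fm_iff[of L "{}" B'] by simp
  from df.D_subst[OF sat_Def[OF this] \<sigma>] have "Def (\<lambda>e. sat M id (\<lambda>n. \<sigma> n e) B')" .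
  moreover have "sat M id (\<lambda>n. \<sigma> n e) B' = holds (e 0) (e 1) B" for e
    unfolding \<sigma>_def holds_def
    using sat_B'[where j = id and e = "\<lambda>_. app_tot M (e 0) (e 1)" and i = "\<lambda>\<delta>. app_tot M \<delta> (e 1)"]
    by simp
  ultimately show "Def (\<lambda>e. holds (e 0) (e 1) B)" by simp
qed

lemma truth_set_DS: "wf_fm L C B \<Longrightarrow> truth_set y B \<in> DS"
  unfolding truth_set_def by (intro Def_def_subsets Def_holds Def_intros)

lemma holds_inst:
  assumes "fv B \<subseteq> {x}"
  shows "holds y w (inst x \<alpha> B) = holds \<alpha> w B"
  unfolding holds_def sat_inst using assms by (intro sat_cong) auto

lemma holds_Conj: "finite \<Phi> \<Longrightarrow> holds y w (Conj \<Phi>) \<longleftrightarrow> (\<forall>A\<in>\<Phi>. holds y w A)"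
  by (simp add: holds_def sat_Conj)

end

subsection \<open>Compact families\<close>

locale saturated_family = sample_space L N M W
  for L :: lang and N :: "nat struc" and M :: "'m struc" and W :: 'm +
  fixes F :: "'m set"
  assumes sat: "aleph1_saturated L M" and fam: "family M W F" and F_nonempty: "F \<noteq> {}"
    and cases: "closed_def_by_cases L M W F" and compact: "compact_family L M F"
begin

lemma app_tot_F: "\<alpha> \<in> F \<Longrightarrow> w \<in> ext M W \<Longrightarrow> app_tot M \<alpha> w = app M \<alpha> w"
  by (rule app_tot_eq[of M "ext M W"]) (use fam in \<open>simp_all add: family_def\<close>)

lemma models_closed_iff:
  assumes "wf_fm L F A" "fv A = {}" "w \<in> ext M W"
  shows "models M (\<lambda>\<delta>. app M \<delta> w) A \<longleftrightarrow> holds y w A"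
proof -
  have "set_fm A \<subseteq> F" using assms(1) wf_fm_iff[of L F A] by simp
  then have "sat M (\<lambda>\<delta>. app M \<delta> w) e A = sat M (\<lambda>\<delta>. app_tot M \<delta> w) e A" for e
    using assms(3) app_tot_F by (intro sat_cong) auto
  then show ?thesis unfolding models_closed[OF assms(2), of _ _ "\<lambda>_. app_tot M y w"] holds_def .
qed

lemma models_inst_iff:
  assumes "wf_fm L F B" "fv B \<subseteq> {x}" "w \<in> ext M W" "\<alpha> \<in> F"
  shows "models M (\<lambda>\<delta>. app M \<delta> w) (inst x \<alpha> B) \<longleftrightarrow> holds \<alpha> w B"
  using assms by (subst models_closed_iff[where y = \<alpha>]) (auto simp: wf_inst fv_inst holds_inst)

text \<open>By compactness, membership in \<open>F\<close> amounts to the countably many conditions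
  \<open>Near k\<close>, and each inclusion is one more definable condition. A member of
  \<open>F\<close> satisfies every \<open>Near k\<close>, so finite satisfiability only concerns the
  inclusions.\<close>

lemma realize_inclusions:
  assumes "countable \<P>" and P: "\<And>u B. (u, B) \<in> \<P> \<Longrightarrow> ext M u \<subseteq> ext M W \<and> wf_fm L C B"
    and fin: "\<And>\<G>. finite \<G> \<Longrightarrow> \<G> \<subseteq> \<P> \<Longrightarrow> \<exists>\<alpha>\<in>F. \<forall>(u, B)\<in>\<G>. ext M u \<subseteq> truth_set \<alpha> B"
  shows "\<exists>\<alpha>\<in>F. \<forall>(u, B)\<in>\<P>. ext M u \<subseteq> truth_set \<alpha> B"
proof -
  obtain H x y where H: "wf_fm L UNIV H" "x \<noteq> y" "fv H \<subseteq> {x, y}"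
    and F: "(\<Inter>k. {b. models M id (inst y b (inst x (numeral_of M k) H))}) = F"
    using compact unfolding compact_family_def Let_def by blast
  define Near where "Near k b \<longleftrightarrow> sat M id ((\<lambda>_. b)(x := numeral_of M k)) H" for k b
  have "models M id (inst y b (inst x (numeral_of M k) H)) = Near k b" for k b
    using H(2,3) by (subst models_inst) (auto simp: fv_inst sat_inst Near_def)
  then have F_iff: "b \<in> F \<longleftrightarrow> (\<forall>k. Near k b)" for b using F by auto
  define Incl where "Incl p b \<longleftrightarrow> (\<forall>w. memb M w (fst p) \<longrightarrow> holds b w (snd p))" for p b
  have Incl_iff: "Incl (u, B) b \<longleftrightarrow> ext M u \<subseteq> truth_set b B" if "(u, B) \<in> \<P>" for u B b
    using P[OF that] by (auto simp: Incl_def truth_set_def mem_ext[symmetric])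
  have "\<exists>b. \<forall>Q\<in>range Near \<union> Incl ` \<P>. Q b"
  proof (rule saturation[OF sat])
    show "countable (range Near \<union> Incl ` \<P>)" using assms(1) by simp
    fix Q assume "Q \<in> range Near \<union> Incl ` \<P>"
    then consider k where "Q = Near k" | u B where "(u, B) \<in> \<P>" "Q = Incl (u, B)" by auto
    then show "Def (\<lambda>e. Q (e 0))"
    proof cases
      case 1
      define \<sigma> where "\<sigma> n e = (if n = x then numeral_of M k else e 0)" for n and e :: "nat \<Rightarrow> 'm"
      have "DefT (\<sigma> n)" for n
        unfolding \<sigma>_def by (cases "n = x") (simp_all add: df.T_numeral df.T_var)
      from df.D_subst[OF sat_Def[OF H(1)] this]
      show ?thesis unfolding 1 Near_def \<sigma>_def fun_upd_def .
    next
      case 2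
      show ?thesis unfolding 2 Incl_def fst_conv snd_conv
        by (intro Def_intros Def_holds) (use P[OF 2(1)] in blast)
    qed
  next
    fix \<Q> assume \<Q>: "finite \<Q>" "\<Q> \<subseteq> range Near \<union> Incl ` \<P>"
    have "finite (\<Q> \<inter> Incl ` \<P>)" "\<Q> \<inter> Incl ` \<P> \<subseteq> Incl ` \<P>" using \<Q>(1) by auto
    from finite_subset_image[OF this] obtain \<G> where
      \<G>: "\<G> \<subseteq> \<P>" "finite \<G>" "\<Q> \<inter> Incl ` \<P> = Incl ` \<G>" by blast
    obtain \<alpha> where \<alpha>: "\<alpha> \<in> F" "\<forall>(u, B)\<in>\<G>. ext M u \<subseteq> truth_set \<alpha> B"
      using fin[OF \<G>(2,1)] by blast
    have "Incl p \<alpha>" if "p \<in> \<G>" for p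
      using bspec[OF \<alpha>(2) that] Incl_iff[OF subsetD[OF \<G>(1)], of "fst p" "snd p" \<alpha>] that
      by (simp add: case_prod_beta)
    moreover have "Near k \<alpha>" for k using \<alpha>(1) F_iff by blast
    ultimately have "Q \<alpha>" if "Q \<in> \<Q>" for Q
    proof -
      have "Q \<in> range Near \<union> Incl ` \<P>" using that \<Q>(2) by (rule subsetD[rotated])
      then consider "Q \<in> Incl ` \<P>" | k where "Q = Near k"
        by (elim UnE imageE) auto
      then show ?thesis
      proof cases
        case 1
        then have "Q \<in> Incl ` \<G>" using that by (simp flip: \<G>(3))
        then show ?thesis using \<open>\<And>p. p \<in> \<G> \<Longrightarrow> Incl p \<alpha>\<close> by (elim imageE) simp
      qed (simp add: \<open>\<And>k. Near k \<alpha>\<close>)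
    qed
    then show "\<exists>b. \<forall>Q\<in>\<Q>. Q b" by (intro exI[of _ \<alpha>] ballI)
  qed
  then obtain b where "\<forall>Q\<in>range Near \<union> Incl ` \<P>. Q b" by (rule exE)
  then have b: "\<And>k. Near k b" "\<And>p. p \<in> \<P> \<Longrightarrow> Incl p b" by (simp_all add: ball_Un)
  have "b \<in> F" using b(1) by (simp add: F_iff)
  moreover have "\<forall>(u, B)\<in>\<P>. ext M u \<subseteq> truth_set b B"
    using b(2) Incl_iff by fast
  ultimately show ?thesis by blast
qed

text \<open>
  Definition by cases makes the truth sets directed, so that members of \<open>F\<close> come within \<open>1/k\<close> of the
  supremum; saturation merges them into one member that attains it.
\<close>

lemma exists_maximal:
  assumes B: "open_fm B" "wf_fm L F B" "fv B \<subseteq> {x}"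
  shows "\<exists>\<alpha>\<in>F. \<forall>\<beta>\<in>F. truth_set \<beta> B - truth_set \<alpha> B \<in> \<I>"
proof -
  let ?C = "(\<lambda>\<alpha>. truth_set \<alpha> B) ` F"
  have ne: "?C \<noteq> {}" using F_nonempty by simp
  have dir: "\<exists>T\<in>?C. U \<union> V \<subseteq> T" if UV: "U \<in> ?C" "V \<in> ?C" for U V
  proof -
    obtain \<alpha> \<beta> where ab: "\<alpha> \<in> F" "U = truth_set \<alpha> B" "\<beta> \<in> F" "V = truth_set \<beta> B"
      using UV by blast
    obtain \<gamma> where g: "\<gamma> \<in> F" "\<And>w. w \<in> ext M W \<Longrightarrow> app M \<gamma> w =
        (if models M (\<lambda>\<delta>. app M \<delta> w) (inst x \<alpha> B) then app M \<alpha> w else app M \<beta> w)"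
      using cases[unfolded closed_def_by_cases_def, rule_format, OF ab(1,3), of B x] B by blast
    have "w \<in> truth_set \<gamma> B" if w: "w \<in> U \<union> V" for w
    proof -
      have W: "w \<in> ext M W" using w ab by (auto simp: truth_set_def)
      \<comment> \<open>Where \<open>\<alpha>\<close> satisfies \<open>B\<close>, so does
        \<open>\<gamma>\<close>. Elsewhere \<open>\<gamma>\<close> agrees with
        \<open>\<beta>\<close>, and \<open>w\<close> must come from \<open>V\<close>.\<close>
      have "app_tot M \<gamma> w = (if holds \<alpha> w B then app_tot M \<alpha> w else app_tot M \<beta> w)"
        using g(2)[OF W] models_inst_iff[OF B(2,3) W ab(1)] app_tot_F[OF _ W] g(1) ab by simp
      then have "holds \<gamma> w B"
        using w ab by (cases "holds \<alpha> w B") (auto simp: truth_set_def holds_def)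
      then show ?thesis using W by (simp add: truth_set_def)
    qed
    then show ?thesis using g(1) by blast
  qed
  have "\<exists>U\<in>?C. \<forall>V\<in>?C. small k (V - U)" for k
    by (rule directed_almost_max[OF ne _ dir]) (use truth_set_DS[OF B(2)] in auto)
  then have "\<forall>k. \<exists>\<alpha>\<in>F. \<forall>\<beta>\<in>F. small k (truth_set \<beta> B - truth_set \<alpha> B)" by simp
  then obtain a where a: "\<And>k. a k \<in> F"
    "\<And>k \<beta>. \<beta> \<in> F \<Longrightarrow> small k (truth_set \<beta> B - truth_set (a k) B)" by metis
  have "\<forall>k. \<exists>u. ext M u = truth_set (a k) B \<and> ext M u \<subseteq> ext M W"
    using truth_set_DS[OF B(2)] by (metis def_subsets_iff)
  then obtain u where u: "\<And>k. ext M (u k) = truth_set (a k) B" "\<And>k. ext M (u k) \<subseteq> ext M W"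
    by metis
  have "\<exists>\<alpha>\<in>F. \<forall>(u, B)\<in>range (\<lambda>k. (u k, B)). ext M u \<subseteq> truth_set \<alpha> B"
  proof (rule realize_inclusions)
    fix \<G> assume \<G>: "finite \<G>" "\<G> \<subseteq> range (\<lambda>k. (u k, B))"
    have "finite ((\<lambda>p. ext M (fst p)) ` \<G>)" "(\<lambda>p. ext M (fst p)) ` \<G> \<subseteq> ?C"
      using \<G> a(1) u(1) by auto
    from finite_directed_bound[OF ne dir this] obtain \<alpha> where
      \<alpha>: "\<alpha> \<in> F" "(\<Union>p\<in>\<G>. ext M (fst p)) \<subseteq> truth_set \<alpha> B" by auto
    have "case q of (u, B) \<Rightarrow> ext M u \<subseteq> truth_set \<alpha> B" if "q \<in> \<G>" for q
    proof -
      obtain k where "q = (u k, B)" using \<open>q \<in> \<G>\<close> \<G>(2) by blast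
      moreover have "ext M (fst q) \<subseteq> truth_set \<alpha> B"
        using \<alpha>(2) that by (simp add: UN_subset_iff)
      ultimately show ?thesis by simp
    qed
    then show "\<exists>\<alpha>\<in>F. \<forall>(u, B)\<in>\<G>. ext M u \<subseteq> truth_set \<alpha> B"
      using \<alpha>(1) by (intro bexI[of _ \<alpha>] ballI)
  qed (use B(2) u(2) in auto)
  then obtain \<alpha> where \<alpha>: "\<alpha> \<in> F" "\<And>k. truth_set (a k) B \<subseteq> truth_set \<alpha> B"
    using u(1) by auto
  have "truth_set \<beta> B - truth_set \<alpha> B \<in> \<I>" if "\<beta> \<in> F" for \<beta>
  proof -
    \<comment> \<open>The truth set of \<open>\<alpha>\<close> includes that of \<open>a k\<close>,
      so even less is missing.\<close>
    have "small k (truth_set \<beta> B - truth_set \<alpha> B)" for k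
      by (rule small_mono[OF _ _ _ a(2)[OF that]])
        (use \<alpha>(2)[of k] truth_set_DS[OF B(2)] in \<open>auto intro: def_subsets_Diff\<close>)
    then show ?thesis using truth_set_DS[OF B(2)] by (simp add: ideal_iff def_subsets_Diff)
  qed
  then show ?thesis using \<alpha>(1) by blast
qed

section \<open>Truth values in \<open>K(F)\<close>\<close>

text \<open>On classes the Boolean operations are those of the representatives. The sentence has no
  free variable for \<open>y\<close> to act on, so \<open>y\<close> is arbitrary.\<close>

lemma bval_open:
  "open_fm A \<Longrightarrow> wf_fm L F A \<Longrightarrow> fv A = {} \<Longrightarrow> bval L M W F A = cls (truth_set y A)"
proof (induction A)
  case (Neg A)
  have "truth_set y (Neg A) = ext M W - truth_set y A"
    by (auto simp: truth_set_def holds_def)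
  then show ?case using Neg truth_set_DS[of F A] by (simp add: compl_cls)
next
  case (And A B)
  have "truth_set y (And A B) = truth_set y A \<inter> truth_set y B"
    by (auto simp: truth_set_def holds_def)
  then show ?case using And truth_set_DS[of F A] truth_set_DS[of F B] by (simp add: meet_cls)
next
  case (Or A B)
  have "truth_set y (Or A B) = truth_set y A \<union> truth_set y B"
    by (auto simp: truth_set_def holds_def)
  then show ?case using Or truth_set_DS[of F A] truth_set_DS[of F B] by (simp add: join_cls)
qed (simp_all add: atom_class_def truth_set_def models_closed_iff[of _ _ y] cong: conj_cong Collect_cong)

lemma bval_inst:
  assumes "open_fm B" "wf_fm L F B" "fv B \<subseteq> {x}" "\<alpha> \<in> F"
  shows "bval L M W F (inst x \<alpha> B) = cls (truth_set \<alpha> B)"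
  using assms bval_open[of "inst x \<alpha> B" \<alpha>]
  by (simp add: open_inst wf_inst fv_inst truth_set_def holds_inst)

text \<open>A truth set that is largest modulo the ideal is the supremum, so the existential
  quantifier has a witness in \<open>F\<close>.\<close>

lemma bval_Ex:
  assumes B: "open_fm B" "wf_fm L F B" "fv B \<subseteq> {x}"
    and \<alpha>: "\<alpha> \<in> F" "\<And>\<beta>. \<beta> \<in> F \<Longrightarrow> truth_set \<beta> B - truth_set \<alpha> B \<in> \<I>"
  shows "bval L M W F (Ex x B) = cls (truth_set \<alpha> B)"
proof -
  have "(\<lambda>\<beta>. bval L M W F (inst x \<beta> B)) ` F = cls ` ((\<lambda>\<beta>. truth_set \<beta> B) ` F)"
    using bval_inst[OF B] by (simp add: image_image cong: image_cong)
  moreover have "\<Squnion>\<^bsub>BA L M W\<^esub> (cls ` ((\<lambda>\<beta>. truth_set \<beta> B) ` F)) = cls (truth_set \<alpha> B)"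
    by (rule Sup_cls) (use \<alpha> truth_set_DS[OF B(2)] in auto)
  ultimately show ?thesis by simp
qed

lemma saturation_inequality:
  assumes "countable p" and p: "\<forall>A\<in>p. open_fm A \<and> wf_fm L F A \<and> fv A \<subseteq> {x}"
  shows "\<exists>\<alpha>\<in>F.
      \<Sqinter>\<^bsub>BA L M W\<^esub> {bval L M W F (Ex x (Conj \<Phi>)) | \<Phi>. finite \<Phi> \<and> \<Phi> \<subseteq> p}
        \<sqsubseteq>\<^bsub>BA L M W\<^esub> \<Sqinter>\<^bsub>BA L M W\<^esub> {bval L M W F (inst x \<alpha> A) | A. A \<in> p}"
proof -
  let ?Fin = "{\<Phi>. finite \<Phi> \<and> \<Phi> \<subseteq> p}"
  have Conj: "open_fm (Conj \<Phi>)" "wf_fm L F (Conj \<Phi>)" "fv (Conj \<Phi>) \<subseteq> {x}" if "\<Phi> \<in> ?Fin" for \<Phi>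
    using open_Conj[of \<Phi> L F "{x}"] that p by blast+
  have "\<forall>\<Phi>\<in>?Fin. \<exists>\<alpha>\<in>F. \<forall>\<beta>\<in>F. truth_set \<beta> (Conj \<Phi>) - truth_set \<alpha> (Conj \<Phi>) \<in> \<I>"
    using exists_maximal[OF Conj] by blast
  from bchoice[OF this[unfolded Bex_def]]
  obtain a where "\<forall>\<Phi>\<in>?Fin. a \<Phi> \<in> F \<and>
      (\<forall>\<beta>\<in>F. truth_set \<beta> (Conj \<Phi>) - truth_set (a \<Phi>) (Conj \<Phi>) \<in> \<I>)" by (rule exE)
  then have a: "\<And>\<Phi>. \<Phi> \<in> ?Fin \<Longrightarrow> a \<Phi> \<in> F"
    "\<And>\<Phi> \<beta>. \<Phi> \<in> ?Fin \<Longrightarrow> \<beta> \<in> F \<Longrightarrow> truth_set \<beta> (Conj \<Phi>) - truth_set (a \<Phi>) (Conj \<Phi>) \<in> \<I>"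
    by simp_all
  let ?S = "(\<lambda>\<Phi>. truth_set (a \<Phi>) (Conj \<Phi>)) ` ?Fin"
  have S_DS: "?S \<subseteq> DS" using truth_set_DS[OF Conj(2)] by auto
  have "countable ?S" using countable_Collect_finite_subset[OF \<open>countable p\<close>] by simp
  then obtain G where G: "G \<in> DS" "\<Sqinter>\<^bsub>BA L M W\<^esub> (cls ` ?S) = cls G" "\<forall>S\<in>?S. G \<subseteq> S"
    by (rule countable_infimum[OF sat _ S_DS]) (rule that)
  have "{bval L M W F (Ex x (Conj \<Phi>)) | \<Phi>. finite \<Phi> \<and> \<Phi> \<subseteq> p} = (\<lambda>\<Phi>. bval L M W F (Ex x (Conj \<Phi>))) ` ?Fin"
    by blast
  also have "\<dots> = cls ` ?S"
    unfolding image_image by (rule image_cong[OF refl bval_Ex[OF Conj a]])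
  finally have left: "\<Sqinter>\<^bsub>BA L M W\<^esub> {bval L M W F (Ex x (Conj \<Phi>)) | \<Phi>. finite \<Phi> \<and> \<Phi> \<subseteq> p} = cls G"
    by (simp only: G(2))
  obtain g where g: "ext M g = G" "ext M g \<subseteq> ext M W" using G(1) by (rule def_subsetsE)
  have "\<exists>\<alpha>\<in>F. \<forall>(u, B)\<in>Pair g ` p. ext M u \<subseteq> truth_set \<alpha> B"
  proof (rule realize_inclusions)
    fix \<G> assume \<G>: "finite \<G>" "\<G> \<subseteq> Pair g ` p"
    from finite_subset_image[OF this] obtain \<Phi> where \<Phi>: "\<Phi> \<in> ?Fin" "\<G> = Pair g ` \<Phi>" by blast
    \<comment> \<open>The witness for the conjunction handles the finite part \<Phi>, since
      \<open>G\<close> lies in its truth set outright.\<close>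
    have "G \<subseteq> truth_set (a \<Phi>) (Conj \<Phi>)" using \<Phi>(1) by (intro bspec[OF G(3)] imageI)
    then have "G \<subseteq> truth_set (a \<Phi>) A" if "A \<in> \<Phi>" for A
      using that \<Phi>(1) by (auto simp: truth_set_def holds_Conj)
    then show "\<exists>\<alpha>\<in>F. \<forall>(u, B)\<in>\<G>. ext M u \<subseteq> truth_set \<alpha> B"
      using a(1)[OF \<Phi>(1)] \<Phi>(2) g(1) by auto
  qed (use assms g(2) in auto)
  then obtain \<alpha> where \<alpha>: "\<alpha> \<in> F" "\<And>A. A \<in> p \<Longrightarrow> G \<subseteq> truth_set \<alpha> A" using g(1) by auto
  \<comment> \<open>The infimum on the right is again the class of a definable set,
    \<open>G'\<close>. As \<open>G\<close> is contained in every truth set in \<open>?R\<close>, it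
    is below \<open>G'\<close> modulo the ideal.\<close>
  let ?R = "truth_set \<alpha> ` p"
  have R_DS: "?R \<subseteq> DS" using p truth_set_DS by blast
  have "countable ?R" using \<open>countable p\<close> by simp
  then obtain G' where G': "G' \<in> DS" "\<Sqinter>\<^bsub>BA L M W\<^esub> (cls ` ?R) = cls G'" 
    "\<forall>T\<in>DS. (\<forall>S\<in>?R. T - S \<in> \<I>) \<longrightarrow> T - G' \<in> \<I>"
    by (rule countable_infimum[OF sat _ R_DS]) (rule that)
  have "{bval L M W F (inst x \<alpha> A) | A. A \<in> p} = (\<lambda>A. bval L M W F (inst x \<alpha> A)) ` p" by blast
  also have "\<dots> = cls ` ?R"
    unfolding image_image by (rule image_cong[OF refl bval_inst]) (use p \<alpha>(1) in auto)
  finally have right: "\<Sqinter>\<^bsub>BA L M W\<^esub> {bval L M W F (inst x \<alpha> A) | A. A \<in> p} = cls G'"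
    by (simp only: G'(2))
  have "G - G' \<in> \<I>"
  proof (rule G'(3)[rule_format, OF G(1)])
    fix S assume "S \<in> ?R"
    then have "G - S = {}" using \<alpha>(2) by blast
    then show "G - S \<in> \<I>" by (simp only: ideal_empty)
  qed
  then show ?thesis
    by (intro bexI[OF _ \<alpha>(1)]) (simp only: left right le_cls[OF G(1) G'(1)])
qed

end

theorem theorem3p2:
  fixes L :: lang and N :: "nat struc" and M :: "'m struc" and W :: 'm and F :: "'m set"
    and p :: "'m fm set" and x :: nat
  assumes "contains_PA_lang L" and "standard_model N" and "definable_lang N L"
    and "true_arithmetic L N M" and "nonstandard M" and "aleph1_saturated L M"
    and "infinite (ext M W)"
    and "family M W F" and "L_closed L M W F" and "closed_def_by_cases L M W F"
    and "compact_family L M F"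
    and "countable p" and "\<forall>A\<in>p. open_fm A \<and> wf_fm L F A \<and> fv A \<subseteq> {x}"
  shows "\<exists>\<alpha>\<in>F.
      \<Sqinter>\<^bsub>BA L M W\<^esub> {bval L M W F (Ex x (Conj \<Phi>)) | \<Phi>. finite \<Phi> \<and> \<Phi> \<subseteq> p}
        \<sqsubseteq>\<^bsub>BA L M W\<^esub> \<Sqinter>\<^bsub>BA L M W\<^esub> {bval L M W F (inst x \<alpha> A) | A. A \<in> p}"
proof -
  \<comment> \<open>Closure under the constant symbol 0 provides an element of
    \<open>F\<close>.\<close>
  have "(0, 0) \<in> funs L" using assms(1) by (auto simp: contains_PA_lang_def PA_lang_def)
  then have "F \<noteq> {}" using assms(9) unfolding L_closed_def by fastforce
  interpret saturated_family L N M W F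
    by unfold_locales (use assms \<open>F \<noteq> {}\<close> in auto)
  show ?thesis using assms(12,13) by (rule saturation_inequality)
qed

end
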